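(* The bialgebra $\overline T(\mathcal{NC})$, with concatenation product and coproduct $\Delta$, equipped with the half-coproducts $\Delta_\prec$ and $\Delta_\succ$ described in the context, is an unshuffle bialgebra.
   Context: $\mathbb K$ is a field of characteristic zero. For $n\ge 1$ let $[n]=\{1,\dots,n\}$. A partition of a finite set $S\subset\mathbb N$ into nonempty disjoint blocks is non-crossing if there are no $p_1<q_1<p_2<q_2$ in $S$ with $p_1,p_2$ in one block and $q_1,q_2$ in a different block. $NC_n$ is the set of non-crossing partitions of $[n]$, and $\mathcal{NC}$ the $\mathbb K$-vector space with basis $\bigcup_{n\ge1}NC_n$ (elements of $NC_n$ have degree $n$). For blocks $B,C$ of a non-crossing partition $L$, write $B<_L C$ iff $\inf C<m<\sup C$ for all $m\in B$. A decomposition $L=Q\sqcup U$ of the set of blocks of $L$ (either part possibly empty) is admissible if there are no $B\in Q$, $C\in U$ with $B<_L C$. For such a decomposition of $L\in NC_n$, let $J_1,\dots,J_k$ be the maximal sets of consecutive integers in $[n]\setminus\bigcup_{B\in Q}B$, ordered left to right; $J_i^{L,Q}$ is the non-crossing partition of $J_i$ formed by the blocks of $U$ contained in $J_i$. The standardization $st$ of a finite $S\subset\mathbb N$ with $|S|=m$ is the increasing bijection $S\to[m]$, applied to partitions of $S$ by transport. $\overline T(\mathcal{NC})=\bigoplus_{k\ge0}\mathcal{NC}^{\otimes k}$ is the unital tensor algebra (elements $L_1|\cdots|L_k$, concatenation product, unit $\mathbf 1$), and $T(\mathcal{NC})=\bigoplus_{k\ge1}\mathcal{NC}^{\otimes k}$.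 The coproduct is $\Delta(L)=\sum_{L=Q\sqcup U\ \text{adm}} st(Q)\otimes(st(J_1^{L,Q})|\cdots|st(J_k^{L,Q}))$ for $L\in NC_n$ (with $st(\emptyset)=\mathbf 1$ and empty bar word $=\mathbf 1$), extended multiplicatively with $\Delta(\mathbf 1)=\mathbf 1\otimes\mathbf 1$. The left half-coproduct $\Delta^+_\prec(L)$ is the same sum restricted to admissible decompositions in which the block of $L$ containing $1$ belongs to $Q$; the right one $\Delta^+_\succ(L)$ is the sum restricted to those in which the block containing $1$ belongs to $U$. Set $\Delta_\prec(L)=\Delta^+_\prec(L)-L\otimes\mathbf 1$, $\Delta_\succ(L)=\Delta^+_\succ(L)-\mathbf 1\otimes L$, extend by $\Delta^+_\prec(L_1|\cdots|L_m)=\Delta^+_\prec(L_1)\Delta(L_2)\cdots\Delta(L_m)$, $\Delta^+_\succ(L_1|\cdots|L_m)=\Delta^+_\succ(L_1)\Delta(L_2)\cdots\Delta(L_m)$, and $\Delta_\prec(w)=\Delta^+_\prec(w)-w\otimes\mathbf 1$, $\Delta_\succ(w)=\Delta^+_\succ(w)-\mathbf 1\otimes w$ for $w\in T(\mathcal{NC})$. An unshuffle bialgebra is a unital, counital bialgebra $\overline B=B\oplus\mathbb K$ (product $\cdot$, coproduct $\Delta$ with $\Delta(c)=\bar\Delta(c)+c\otimes\mathbf 1+\mathbf 1\otimes c$ for $c\in B$) together with maps $\Delta_\prec,\Delta_\succ:B\to B\otimes B$ such that $\bar\Delta=\Delta_\prec+\Delta_\succ$ and: $(\Delta_\prec\otimes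 I)\Delta_\prec=(I\otimes\bar\Delta)\Delta_\prec$; $(\Delta_\succ\otimes I)\Delta_\prec=(I\otimes\Delta_\prec)\Delta_\succ$; $(\bar\Delta\otimes I)\Delta_\succ=(I\otimes\Delta_\succ)\Delta_\succ$; and $\Delta^+_\prec(a\cdot b)=\Delta^+_\prec(a)\cdot\Delta(b)$, $\Delta^+_\succ(a\cdot b)=\Delta^+_\succ(a)\cdot\Delta(b)$, where $\Delta^+_\prec(a)=\Delta_\prec(a)+a\otimes\mathbf 1$ and $\Delta^+_\succ(a)=\Delta_\succ(a)+\mathbf 1\otimes a$. *)

theory Defs
  imports Complex_Main "HOL-Library.Poly_Mapping" "HOL-Library.Disjoint_Sets"
begin

section \<open>Vector spaces with a basis and their tensor products\<close>

text \<open>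
  A vector space over \<open>'k\<close> is presented by a basis \<open>'b\<close>, as the space \<open>'b \<Rightarrow>\<^sub>0 'k\<close> of finitely
  supported functions; the tensor product of the spaces with bases \<open>'b\<close> and \<open>'c\<close> is the space
  with basis \<open>'b \<times> 'c\<close>.
\<close>

definition vscale :: "'k::field \<Rightarrow> ('b \<Rightarrow>\<^sub>0 'k) \<Rightarrow> ('b \<Rightarrow>\<^sub>0 'k)" where
  "vscale c x = Poly_Mapping.map ((*) c) x"

definition basis_vec :: "'b \<Rightarrow> ('b \<Rightarrow>\<^sub>0 'k::field)" where
  "basis_vec b = Poly_Mapping.single b 1"

definition lin_ext :: "('b \<Rightarrow> ('c \<Rightarrow>\<^sub>0 'k::field)) \<Rightarrow> ('b \<Rightarrow>\<^sub>0 'k) \<Rightarrow> ('c \<Rightarrow>\<^sub>0 'k)" where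
  "lin_ext f x = (\<Sum>b\<in>Poly_Mapping.keys x. vscale (Poly_Mapping.lookup x b) (f b))"

definition tensor :: "('b \<Rightarrow>\<^sub>0 'k::field) \<Rightarrow> ('c \<Rightarrow>\<^sub>0 'k) \<Rightarrow> ('b \<times> 'c \<Rightarrow>\<^sub>0 'k)" where
  "tensor x y = (\<Sum>b\<in>Poly_Mapping.keys x. \<Sum>c\<in>Poly_Mapping.keys y.
     Poly_Mapping.single (b, c) (Poly_Mapping.lookup x b * Poly_Mapping.lookup y c))"

definition tensor_map ::
  "(('b \<Rightarrow>\<^sub>0 'k::field) \<Rightarrow> ('d \<Rightarrow>\<^sub>0 'k)) \<Rightarrow> (('c \<Rightarrow>\<^sub>0 'k) \<Rightarrow> ('e \<Rightarrow>\<^sub>0 'k))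
    \<Rightarrow> ('b \<times> 'c \<Rightarrow>\<^sub>0 'k) \<Rightarrow> ('d \<times> 'e \<Rightarrow>\<^sub>0 'k)" where
  "tensor_map f g = lin_ext (\<lambda>(b, c). tensor (f (basis_vec b)) (g (basis_vec c)))"

definition tensor_assoc :: "(('b \<times> 'c) \<times> 'd \<Rightarrow>\<^sub>0 'k::field) \<Rightarrow> ('b \<times> 'c \<times> 'd \<Rightarrow>\<^sub>0 'k)" where
  "tensor_assoc = lin_ext (\<lambda>((b, c), d). basis_vec (b, c, d))"

definition tensor_subspace ::
  "('b \<Rightarrow>\<^sub>0 'k::field) set \<Rightarrow> ('c \<Rightarrow>\<^sub>0 'k) set \<Rightarrow> ('b \<times> 'c \<Rightarrow>\<^sub>0 'k) set" where
  "tensor_subspace V W = module.span vscale {tensor x y | x y. x \<in> V \<and> y \<in> W}"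

definition tensor_mult ::
  "(('b \<Rightarrow>\<^sub>0 'k::field) \<Rightarrow> ('b \<Rightarrow>\<^sub>0 'k) \<Rightarrow> ('b \<Rightarrow>\<^sub>0 'k))
    \<Rightarrow> ('b \<times> 'b \<Rightarrow>\<^sub>0 'k) \<Rightarrow> ('b \<times> 'b \<Rightarrow>\<^sub>0 'k) \<Rightarrow> ('b \<times> 'b \<Rightarrow>\<^sub>0 'k)" where
  "tensor_mult m s t =
     lin_ext (\<lambda>(a, b). lin_ext (\<lambda>(c, d).
       tensor (m (basis_vec a) (basis_vec c)) (m (basis_vec b) (basis_vec d))) t) s"

lemma vector_space_vscale: "vector_space (vscale :: 'k::field \<Rightarrow> ('b \<Rightarrow>\<^sub>0 'k) \<Rightarrow> ('b \<Rightarrow>\<^sub>0 'k))"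
proof -
  have "Poly_Mapping.lookup (vscale c x) b = c * Poly_Mapping.lookup x b"
    for c :: 'k and x :: "'b \<Rightarrow>\<^sub>0 'k" and b
    by (simp add: vscale_def map.rep_eq when_def)
  then show ?thesis
    by unfold_locales (auto simp: lookup_add algebra_simps intro!: poly_mapping_eqI)
qed

section \<open>Unshuffle bialgebras\<close>

locale bialgebra =
  fixes mult :: "('b \<Rightarrow>\<^sub>0 'k::field) \<Rightarrow> ('b \<Rightarrow>\<^sub>0 'k) \<Rightarrow> ('b \<Rightarrow>\<^sub>0 'k)"
    and one :: "'b \<Rightarrow>\<^sub>0 'k"
    and \<Delta> :: "('b \<Rightarrow>\<^sub>0 'k) \<Rightarrow> ('b \<times> 'b \<Rightarrow>\<^sub>0 'k)"
    and \<epsilon> :: "('b \<Rightarrow>\<^sub>0 'k) \<Rightarrow> 'k"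
  assumes mult_linear_right: "Vector_Spaces.linear vscale vscale (\<lambda>y. mult x y)"
    and mult_linear_left: "Vector_Spaces.linear vscale vscale (\<lambda>x. mult x y)"
    and mult_assoc: "mult (mult x y) z = mult x (mult y z)"
    and mult_one_left: "mult one x = x"
    and mult_one_right: "mult x one = x"
    and coproduct_linear: "Vector_Spaces.linear vscale vscale \<Delta>"
    and coassoc: "tensor_assoc (tensor_map \<Delta> id (\<Delta> x)) = tensor_map id \<Delta> (\<Delta> x)"
    and counit_linear: "Vector_Spaces.linear vscale (*) \<epsilon>"
    and counit_left: "lin_ext (\<lambda>(b, c). vscale (\<epsilon> (basis_vec b)) (basis_vec c)) (\<Delta> x) = x"
    and counit_right: "lin_ext (\<lambda>(b, c). vscale (\<epsilon> (basis_vec c)) (basis_vec b)) (\<Delta> x) = x"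
    and coproduct_mult: "\<Delta> (mult x y) = tensor_mult mult (\<Delta> x) (\<Delta> y)"
    and coproduct_one: "\<Delta> one = tensor one one"
    and counit_mult: "\<epsilon> (mult x y) = \<epsilon> x * \<epsilon> y"
    and counit_one: "\<epsilon> one = 1"
begin

definition reduced_coproduct :: "('b \<Rightarrow>\<^sub>0 'k) \<Rightarrow> ('b \<times> 'b \<Rightarrow>\<^sub>0 'k)" where
  "reduced_coproduct x = \<Delta> x - tensor x one - tensor one x"

end

text \<open>
  The space \<open>B\<close> is the augmentation ideal; as \<open>\<epsilon> one = 1\<close>, the whole space is the direct sum of \<open>B\<close>
  and the line spanned by \<open>one\<close>. A linear map on \<open>B\<close> is represented by a linear extension to the
  whole space; which one is immaterial, since only its values on \<open>B\<close> enter into the axioms.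
\<close>

locale unshuffle_bialgebra = bialgebra mult one \<Delta> \<epsilon>
  for mult :: "('b \<Rightarrow>\<^sub>0 'k::field) \<Rightarrow> ('b \<Rightarrow>\<^sub>0 'k) \<Rightarrow> ('b \<Rightarrow>\<^sub>0 'k)"
    and one :: "'b \<Rightarrow>\<^sub>0 'k"
    and \<Delta> :: "('b \<Rightarrow>\<^sub>0 'k) \<Rightarrow> ('b \<times> 'b \<Rightarrow>\<^sub>0 'k)"
    and \<epsilon> :: "('b \<Rightarrow>\<^sub>0 'k) \<Rightarrow> 'k" +
  fixes B :: "('b \<Rightarrow>\<^sub>0 'k) set"
    and \<Delta>prec :: "('b \<Rightarrow>\<^sub>0 'k) \<Rightarrow> ('b \<times> 'b \<Rightarrow>\<^sub>0 'k)"
    and \<Delta>succ :: "('b \<Rightarrow>\<^sub>0 'k) \<Rightarrow> ('b \<times> 'b \<Rightarrow>\<^sub>0 'k)"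
  assumes augmentation: "B = {x. \<epsilon> x = 0}"
    and prec_linear: "Vector_Spaces.linear vscale vscale \<Delta>prec"
    and succ_linear: "Vector_Spaces.linear vscale vscale \<Delta>succ"
    and prec_in: "x \<in> B \<Longrightarrow> \<Delta>prec x \<in> tensor_subspace B B"
    and succ_in: "x \<in> B \<Longrightarrow> \<Delta>succ x \<in> tensor_subspace B B"
    and reduced_split: "x \<in> B \<Longrightarrow> reduced_coproduct x = \<Delta>prec x + \<Delta>succ x"
    and prec_prec: "x \<in> B \<Longrightarrow>
      tensor_assoc (tensor_map \<Delta>prec id (\<Delta>prec x)) = tensor_map id reduced_coproduct (\<Delta>prec x)"
    and succ_prec: "x \<in> B \<Longrightarrow>
      tensor_assoc (tensor_map \<Delta>succ id (\<Delta>prec x)) = tensor_map id \<Delta>prec (\<Delta>succ x)"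
    and succ_succ: "x \<in> B \<Longrightarrow>
      tensor_assoc (tensor_map reduced_coproduct id (\<Delta>succ x)) = tensor_map id \<Delta>succ (\<Delta>succ x)"
    and prec_plus_mult: "x \<in> B \<Longrightarrow> y \<in> B \<Longrightarrow>
      \<Delta>prec (mult x y) + tensor (mult x y) one = tensor_mult mult (\<Delta>prec x + tensor x one) (\<Delta> y)"
    and succ_plus_mult: "x \<in> B \<Longrightarrow> y \<in> B \<Longrightarrow>
      \<Delta>succ (mult x y) + tensor one (mult x y) = tensor_mult mult (\<Delta>succ x + tensor one x) (\<Delta> y)"

section \<open>Non-crossing partitions\<close>

definition noncrossing :: "nat set set \<Rightarrow> bool" where
  "noncrossing P \<longleftrightarrow> \<not> (\<exists>B\<in>P. \<exists>C\<in>P. B \<noteq> C \<and>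
     (\<exists>p1\<in>B. \<exists>q1\<in>C. \<exists>p2\<in>B. \<exists>q2\<in>C. p1 < q1 \<and> q1 < p2 \<and> p2 < q2))"

definition NC :: "nat \<Rightarrow> nat set set set" where
  "NC n = {P. partition_on {1..n} P \<and> noncrossing P}"

typedef ncp = "\<Union>n\<in>{1..}. NC n"
  morphisms blocks Abs_ncp
proof
  have "{{1}} \<in> NC 1"
    by (auto simp: NC_def noncrossing_def partition_on_def)
  then show "{{1}} \<in> (\<Union>n\<in>{1..}. NC n)"
    by blast
qed

definition nested :: "nat set \<Rightarrow> nat set \<Rightarrow> bool" where
  "nested B C \<longleftrightarrow> (\<forall>m\<in>B. Min C < m \<and> m < Max C)"

text \<open>A decomposition \<open>L = Q \<squnion> U\<close> is given by \<open>Q\<close> alone, with \<open>U = L - Q\<close>.\<close>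

definition admissible :: "nat set set \<Rightarrow> nat set set set" where
  "admissible L = {Q. Q \<subseteq> L \<and> \<not> (\<exists>B\<in>Q. \<exists>C\<in>L - Q. nested B C)}"

definition is_run :: "nat set \<Rightarrow> bool" where
  "is_run J \<longleftrightarrow> (\<exists>a b. a \<le> b \<and> J = {a..b})"

definition max_runs :: "nat set \<Rightarrow> nat set set" where
  "max_runs S = {J. is_run J \<and> J \<subseteq> S \<and> (\<forall>J'. is_run J' \<and> J \<subseteq> J' \<and> J' \<subseteq> S \<longrightarrow> J' = J)}"

definition max_run_list :: "nat set \<Rightarrow> nat set list" where
  "max_run_list S = (THE Js. set Js = max_runs S \<and> sorted_wrt (\<lambda>I J. Max I < Min J) Js)"

definition st :: "nat set \<Rightarrow> nat \<Rightarrow> nat" where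
  "st S x = card {y \<in> S. y \<le> x}"

lemma st_strict_mono_on:
  assumes "finite S"
  shows "strict_mono_on S (st S)"
proof (rule strict_mono_onI)
  fix x y assume "x \<in> S" "y \<in> S" "x < y"
  then have "y \<in> {z \<in> S. z \<le> y}" "y \<notin> {z \<in> S. z \<le> x}" "{z \<in> S. z \<le> x} \<subseteq> {z \<in> S. z \<le> y}"
    by auto
  then have "{z \<in> S. z \<le> x} \<subset> {z \<in> S. z \<le> y}"
    by blast
  then show "st S x < st S y"
    unfolding st_def using assms by (intro psubset_card_mono) auto
qed

lemma st_bij_betw:
  assumes "finite S"
  shows "bij_betw (st S) S {1..card S}"
proof -
  have inj: "inj_on (st S) S"
    using st_strict_mono_on[OF assms] by (rule strict_mono_on_imp_inj_on)
  have "st S ` S \<subseteq> {1..card S}"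
  proof
    fix k assume "k \<in> st S ` S"
    then obtain x where x: "x \<in> S" "k = card {y \<in> S. y \<le> x}"
      by (auto simp: st_def)
    have "{y \<in> S. y \<le> x} \<noteq> {}"
      using x by auto
    then have "k > 0"
      using assms x by (simp add: card_gt_0_iff)
    moreover have "k \<le> card S"
      unfolding x using assms by (intro card_mono) auto
    ultimately show "k \<in> {1..card S}"
      by simp
  qed
  then have "st S ` S = {1..card S}"
    using inj by (intro card_subset_eq) (auto simp: card_image)
  then show ?thesis
    using inj by (simp add: bij_betw_def)
qed

definition standardize :: "nat set set \<Rightarrow> nat set set" where
  "standardize P = (\<lambda>B. st (\<Union>P) ` B) ` P"

lemma standardize_NC:
  assumes "finite (\<Union>P)" "partition_on (\<Union>P) P" "noncrossing P"
  shows "standardize P \<in> NC (card (\<Union>P))"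
proof -
  let ?S = "\<Union>P"
  have bij: "bij_betw (st ?S) ?S {1..card ?S}"
    using assms(1) by (rule st_bij_betw)
  then have inj: "inj_on (st ?S) ?S"
    by (rule bij_betw_imp_inj_on)
  have less: "st ?S x < st ?S y \<longleftrightarrow> x < y" if "x \<in> ?S" "y \<in> ?S" for x y
    using strict_mono_on_less[OF st_strict_mono_on[OF assms(1)] that] .
  have "\<Union>(standardize P) = st ?S ` ?S"
    by (auto simp: standardize_def)
  then have "\<Union>(standardize P) = {1..card ?S}"
    using bij by (simp add: bij_betw_def)
  moreover have "disjoint (standardize P)"
  proof (rule disjointI)
    fix X Y assume "X \<in> standardize P" "Y \<in> standardize P" "X \<noteq> Y"
    then obtain B C where BC: "B \<in> P" "C \<in> P" "B \<noteq> C" "X = st ?S ` B" "Y = st ?S ` C"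
      by (auto simp: standardize_def)
    then have "B \<inter> C = {}"
      using assms(2) by (auto simp: partition_on_def disjoint_def)
    moreover have "st ?S ` (B \<inter> C) = st ?S ` B \<inter> st ?S ` C"
      using inj BC by (intro inj_on_image_Int[of _ ?S]) auto
    ultimately show "X \<inter> Y = {}"
      using BC by simp
  qed
  moreover have "{} \<notin> standardize P"
    using assms(2) by (auto simp: standardize_def partition_on_def)
  moreover have "noncrossing (standardize P)"
    unfolding noncrossing_def
  proof
    assume "\<exists>X\<in>standardize P. \<exists>Y\<in>standardize P. X \<noteq> Y \<and>
      (\<exists>p1\<in>X. \<exists>q1\<in>Y. \<exists>p2\<in>X. \<exists>q2\<in>Y. p1 < q1 \<and> q1 < p2 \<and> p2 < q2)"
    then obtain X Y r1 s1 r2 s2 where XY: "X \<in> standardize P" "Y \<in> standardize P" "X \<noteq> Y"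
      "r1 \<in> X" "s1 \<in> Y" "r2 \<in> X" "s2 \<in> Y" "r1 < s1" "s1 < r2" "r2 < s2"
      by (elim bexE conjE) (rule that)
    obtain B C where BC: "B \<in> P" "C \<in> P" "X = st ?S ` B" "Y = st ?S ` C"
      using XY(1,2) by (auto simp: standardize_def)
    obtain p1 p2 where p: "p1 \<in> B" "p2 \<in> B" "r1 = st ?S p1" "r2 = st ?S p2"
      using XY(4,6) BC(3) by auto
    obtain q1 q2 where q: "q1 \<in> C" "q2 \<in> C" "s1 = st ?S q1" "s2 = st ?S q2"
      using XY(5,7) BC(4) by auto
    have "B \<noteq> C"
      using XY(3) BC(3,4) by metis
    then have *: "B \<in> P" "C \<in> P" "B \<noteq> C" "p1 \<in> B" "q1 \<in> C" "p2 \<in> B" "q2 \<in> C"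
      "st ?S p1 < st ?S q1" "st ?S q1 < st ?S p2" "st ?S p2 < st ?S q2"
      using XY BC p q by simp_all
    have S: "p1 \<in> ?S" "q1 \<in> ?S" "p2 \<in> ?S" "q2 \<in> ?S"
      using *(1,2,4-7) by auto
    have "p1 < q1 \<and> q1 < p2 \<and> p2 < q2"
      using *(8-10) less[OF S(1,2)] less[OF S(2,3)] less[OF S(3,4)] by simp
    then have "\<exists>p1\<in>B. \<exists>q1\<in>C. \<exists>p2\<in>B. \<exists>q2\<in>C. p1 < q1 \<and> q1 < p2 \<and> p2 < q2"
      using *(4-7) by (intro bexI)
    then have "\<not> noncrossing P"
      unfolding noncrossing_def not_not using *(1-3) by (intro bexI[of _ B] bexI[of _ C] conjI)
    then show False
      using assms(3) by simp
  qed
  ultimately show ?thesis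
    by (simp add: NC_def partition_on_def)
qed

definition st_word :: "nat set set \<Rightarrow> ncp list" where
  "st_word Q = (if Q = {} then [] else [Abs_ncp (standardize Q)])"

definition pieces :: "nat set set \<Rightarrow> nat set set \<Rightarrow> ncp list" where
  "pieces L Q =
     map (\<lambda>J. Abs_ncp (standardize {B \<in> L - Q. B \<subseteq> J})) (max_run_list (\<Union>L - \<Union>Q))"

section \<open>The tensor algebra on non-crossing partitions\<close>

text \<open>The unital tensor algebra has the words in non-crossing partitions as a basis.\<close>

type_synonym 'k ncT = "ncp list \<Rightarrow>\<^sub>0 'k"
type_synonym 'k ncT2 = "ncp list \<times> ncp list \<Rightarrow>\<^sub>0 'k"

definition conc :: "'k::field ncT \<Rightarrow> 'k ncT \<Rightarrow> 'k ncT" where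
  "conc x y = lin_ext (\<lambda>v. lin_ext (\<lambda>w. basis_vec (v @ w)) y) x"

definition unit_T :: "'k::field ncT" where
  "unit_T = basis_vec []"

definition counit_T :: "'k::field ncT \<Rightarrow> 'k" where
  "counit_T x = Poly_Mapping.lookup x []"

definition T_plus :: "'k::field ncT set" where
  "T_plus = {x. Poly_Mapping.keys x \<subseteq> {w. w \<noteq> []}}"

definition coprod_sum :: "(nat set set \<Rightarrow> bool) \<Rightarrow> ncp \<Rightarrow> 'k::field ncT2" where
  "coprod_sum C L =
     (\<Sum>Q\<in>{Q \<in> admissible (blocks L). C Q}. basis_vec (st_word Q, pieces (blocks L) Q))"

definition coprod_gen :: "ncp \<Rightarrow> 'k::field ncT2" where
  "coprod_gen = coprod_sum (\<lambda>Q. True)"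

definition prec_plus_gen :: "ncp \<Rightarrow> 'k::field ncT2" where
  "prec_plus_gen L = coprod_sum (\<lambda>Q. \<exists>B\<in>Q. 1 \<in> B) L"

definition succ_plus_gen :: "ncp \<Rightarrow> 'k::field ncT2" where
  "succ_plus_gen L = coprod_sum (\<lambda>Q. \<exists>B\<in>blocks L - Q. 1 \<in> B) L"

primrec coprod_word :: "ncp list \<Rightarrow> 'k::field ncT2" where
  "coprod_word [] = tensor unit_T unit_T"
| "coprod_word (L # w) = tensor_mult conc (coprod_gen L) (coprod_word w)"

text \<open>The half-coproducts live on the span of the nonempty words and are extended by zero.\<close>

primrec prec_word :: "ncp list \<Rightarrow> 'k::field ncT2" where
  "prec_word [] = 0"
| "prec_word (L # w) =
     tensor_mult conc (prec_plus_gen L) (coprod_word w) - tensor (basis_vec (L # w)) unit_T"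

primrec succ_word :: "ncp list \<Rightarrow> 'k::field ncT2" where
  "succ_word [] = 0"
| "succ_word (L # w) =
     tensor_mult conc (succ_plus_gen L) (coprod_word w) - tensor unit_T (basis_vec (L # w))"

definition coprod :: "'k::field ncT \<Rightarrow> 'k ncT2" where
  "coprod = lin_ext coprod_word"

definition coprod_prec :: "'k::field ncT \<Rightarrow> 'k ncT2" where
  "coprod_prec = lin_ext prec_word"

definition coprod_succ :: "'k::field ncT \<Rightarrow> 'k ncT2" where
  "coprod_succ = lin_ext succ_word"

end

theory Submission
  imports Defs
begin

text \<open>
  Fix a set \<open>A\<close> of separating integers and a non-crossing family \<open>V\<close> of finite blocks none of which
  straddles an element of \<open>A\<close>. The elements of \<open>A\<close> cut \<open>V\<close> into consecutive pieces; their
  standardizations form a word \<open>w(A, V)\<close>, and every word arises in this way. Both factors of the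
  terms of the coproduct are again such words, so that
  \<open>\<Delta> (w(A, V)) = \<Sum>\<^sub>R w(A, R) \<otimes> w(A \<union> \<Union>R, V - R)\<close>,
  the sum ranging over the admissible \<open>R \<subseteq> V\<close>; the half-coproducts restrict it by
  whether the least point of \<open>V\<close> lies in \<open>R\<close>. Coassociativity and the three half-coassociativity
  relations all follow from the bijection between pairs \<open>P \<subseteq> Q\<close> with \<open>Q\<close> admissible
  in \<open>V\<close> and \<open>P\<close> admissible in \<open>Q\<close>, and pairs of \<open>P\<close> admissible in \<open>V\<close> and
  \<open>R = Q - P\<close> admissible in \<open>V - P\<close>, split according to whether the least point lies
  in \<open>P\<close>, in \<open>Q - P\<close> or outside \<open>Q\<close>.
\<close>

section \<open>Words of separated non-crossing families\<close>

text \<open>Standardization relabels both factors at every stage, and the right factor is a word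
  whose letters come from different intervals, so iterated coproducts are hard to compare letter by
  letter. A pair \<open>(A, V)\<close> keeps the original positions instead. Removing the blocks of
  \<open>R\<close> leaves holes at \<open>\<Union>R\<close>, and these holes decide where the bars
  of the right factor stand, hence the enlarged separator set; the left factor closes its holes, so
  its separators remain \<open>A\<close>. Both iterated coproducts become sums over pairs of
  subfamilies of one fixed \<open>V\<close>, and standardization survives only inside the labels of
  basis vectors. The expansion has to be known for words and not only for letters, because the
  second coproduct acts on a word; a cut of \<open>V\<close> at an element of \<open>A\<close>
  matches the multiplicative extension, and the least point of \<open>V\<close> lies left of the
  cut, as the half-coproducts require. The relations are proved for the unreduced half-coproducts;
  the reduced ones differ from them by unit terms that cancel.\<close>

definition sep_class :: "nat set \<Rightarrow> nat set \<Rightarrow> nat \<Rightarrow> nat set" where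
  "sep_class A S x = {y \<in> S. \<forall>a\<in>A. \<not> (x < a \<and> a < y) \<and> \<not> (y < a \<and> a < x)}"

definition sep_classes :: "nat set \<Rightarrow> nat set \<Rightarrow> nat set set" where
  "sep_classes A S = sep_class A S ` S"

definition splits :: "nat set \<Rightarrow> nat set \<Rightarrow> bool" where
  "splits A S \<longleftrightarrow> (\<exists>a\<in>A. \<exists>x\<in>S. \<exists>y\<in>S. x < a \<and> a < y)"

text \<open>The description that defines \<open>max_run_list\<close>, with the set of runs made a
  parameter, so that it also lists separation classes of sets that are not unions of runs between
  the elements of \<open>A\<close>.\<close>

definition ordered_list :: "nat set set \<Rightarrow> nat set list" where
  "ordered_list X = (THE Js. set Js = X \<and> sorted_wrt (\<lambda>I J. Max I < Min J) Js)"

definition sep_word :: "nat set \<Rightarrow> nat set set \<Rightarrow> ncp list" where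
  "sep_word A V =
     map (\<lambda>J. Abs_ncp (standardize {B \<in> V. B \<subseteq> J})) (ordered_list (sep_classes A (\<Union>V)))"

text \<open>Finite nonempty sets satisfy \<open>Min I \<le> Max I\<close>, so such a list has
  strictly increasing minima. A strictly increasing list is determined by its set, and
  \<open>Min\<close> is injective on the members, hence the minima determine the list.\<close>

lemma ordered_list_eqI:
  assumes "set Js = X" "sorted_wrt (\<lambda>I J. Max I < Min J) Js" "\<And>J. J \<in> X \<Longrightarrow> finite J \<and> J \<noteq> {}"
  shows "ordered_list X = Js"
proof -
  have key: "sorted_wrt (<) (map Min Ks) \<and> inj_on Min (set Ks)"
    if "set Ks = X" "sorted_wrt (\<lambda>I J. Max I < Min J) Ks" for Ks :: "nat set list"
  proof -
    have "sorted_wrt (\<lambda>I J. Min I < Min J) Ks"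
      using that(2)
    proof (rule sorted_wrt_mono_rel[rotated])
      fix I J assume "I \<in> set Ks" "J \<in> set Ks" "Max I < Min J"
      then show "Min I < Min J"
        using assms(3)[of I] that(1) by (metis Max_ge Min_in le_less_trans)
    qed
    then have s: "sorted_wrt (<) (map Min Ks)"
      by (simp only: sorted_wrt_map)
    then have "distinct (map Min Ks)"
      by (simp add: strict_sorted_iff)
    then show ?thesis
      using s by (simp add: distinct_map)
  qed
  have uniq: "Ks = Js" if K: "set Ks = X" "sorted_wrt (\<lambda>I J. Max I < Min J) Ks" for Ks
  proof -
    have "map Min Ks = map Min Js"
      using key[OF K] key[OF assms(1,2)] K(1) assms(1)
      by (intro sorted_distinct_set_unique) (simp_all add: strict_sorted_iff)
    then show ?thesis
      using key[OF K] K(1) assms(1) by (metis inj_on_map_eq_map sup.idem)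
  qed
  show ?thesis
    unfolding ordered_list_def
  proof (rule the_equality)
    show "set Js = X \<and> sorted_wrt (\<lambda>I J. Max I < Min J) Js"
      using assms(1,2) by blast
    show "Ks = Js" if "set Ks = X \<and> sorted_wrt (\<lambda>I J. Max I < Min J) Ks" for Ks
      using uniq that by blast
  qed
qed

lemma sep_classes_subset: "J \<in> sep_classes A S \<Longrightarrow> J \<subseteq> S"
  by (auto simp: sep_classes_def sep_class_def)

lemma sep_classes_nonempty: "J \<in> sep_classes A S \<Longrightarrow> J \<noteq> {}"
  by (auto simp: sep_classes_def sep_class_def)

lemma sep_classes_single:
  assumes "S \<noteq> {}" "\<not> splits A S"
  shows "sep_classes A S = {S}"
proof -
  have "sep_class A S x = S" if "x \<in> S" for x
    using assms(2) that unfolding splits_def sep_class_def by blast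
  then show ?thesis
    using assms(1) by (auto simp: sep_classes_def)
qed

text \<open>The separator \<open>a\<close> stands between every point of \<open>S1\<close> and every
  point of \<open>S2\<close>, so no class meets both sides.\<close>

lemma sep_classes_Un:
  assumes "a \<in> A" "\<And>x. x \<in> S1 \<Longrightarrow> x < a" "\<And>x. x \<in> S2 \<Longrightarrow> a < x"
  shows "sep_classes A (S1 \<union> S2) = sep_classes A S1 \<union> sep_classes A S2"
proof -
  have "sep_class A (S1 \<union> S2) x = sep_class A S1 x" if "x \<in> S1" for x
    using assms that unfolding sep_class_def by blast
  moreover have "sep_class A (S1 \<union> S2) x = sep_class A S2 x" if "x \<in> S2" for x
    using assms that unfolding sep_class_def by blast
  ultimately show ?thesis
    unfolding sep_classes_def image_Un by (metis (no_types, lifting) image_cong)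
qed

text \<open>This makes the definite description meaningful. Either no separator splits
  \<open>S\<close> and there is a single class, or a separator cuts \<open>S\<close> into two
  smaller sets; it is itself outside \<open>S\<close>, so no point is lost, and the two lists are
  concatenated.\<close>

lemma ordered_list_sep_classes:
  assumes "finite S" "A \<inter> S = {}"
  shows "set (ordered_list (sep_classes A S)) = sep_classes A S
    \<and> sorted_wrt (\<lambda>I J. Max I < Min J) (ordered_list (sep_classes A S))"
proof -
  have "\<exists>Js. set Js = sep_classes A S \<and> sorted_wrt (\<lambda>I J. Max I < Min J) Js"
    using assms
  proof (induction S rule: finite_psubset_induct)
    case (psubset S)
    consider "S = {}" | "S \<noteq> {}" "\<not> splits A S" | "splits A S"
      by blast
    then show ?case
    proof cases
      case 1
      then show ?thesis
        by (intro exI[of _ "[]"]) (simp add: sep_classes_def)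
    next
      case 2
      then show ?thesis
        by (intro exI[of _ "[S]"]) (simp add: sep_classes_single)
    next
      case 3
      then obtain a x y where a: "a \<in> A" "x \<in> S" "y \<in> S" "x < a" "a < y"
        by (auto simp: splits_def)
      define S1 where "S1 = {x \<in> S. x < a}"
      define S2 where "S2 = {x \<in> S. a < x}"
      have S: "S = S1 \<union> S2"
      proof -
        have "a \<notin> S"
          using a psubset.prems by blast
        then have "x < a \<or> a < x" if "x \<in> S" for x
          using that by (cases x a rule: linorder_cases) auto
        then show ?thesis
          by (auto simp: S1_def S2_def)
      qed
      have sub: "S1 \<subset> S" "S2 \<subset> S" and "A \<inter> S1 = {}" "A \<inter> S2 = {}"
        using a psubset.prems less_asym[of a] unfolding S1_def S2_def by blast+
      then obtain J1 J2 where J: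
        "set J1 = sep_classes A S1" "sorted_wrt (\<lambda>I J. Max I < Min J) J1"
        "set J2 = sep_classes A S2" "sorted_wrt (\<lambda>I J. Max I < Min J) J2"
        using psubset.IH[of S1] psubset.IH[of S2] by blast
      have "Max I < Min J" if "I \<in> sep_classes A S1" "J \<in> sep_classes A S2" for I J
      proof -
        have I: "I \<subseteq> S1" "I \<noteq> {}" and J: "J \<subseteq> S2" "J \<noteq> {}"
          using that sep_classes_subset sep_classes_nonempty by blast+
        have "finite I" "finite J"
          using I J psubset.hyps S by (metis finite_Un finite_subset)+
        then have "Max I \<in> I" "Min J \<in> J"
          using I J by auto
        then have "Max I < a" "a < Min J"
          using I J by (auto simp: S1_def S2_def)
        then show ?thesis
          by simp
      qed
      moreover have "sep_classes A S = sep_classes A S1 \<union> sep_classes A S2"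
        unfolding S by (rule sep_classes_Un[OF a(1)]) (auto simp: S1_def S2_def)
      ultimately show ?thesis
        using J by (intro exI[of _ "J1 @ J2"]) (simp add: sorted_wrt_append)
    qed
  qed
  then obtain Js where Js: "set Js = sep_classes A S" "sorted_wrt (\<lambda>I J. Max I < Min J) Js"
    by blast
  then have "ordered_list (sep_classes A S) = Js"
  proof (rule ordered_list_eqI)
    show "finite J \<and> J \<noteq> {}" if "J \<in> sep_classes A S" for J
      using sep_classes_subset[OF that] sep_classes_nonempty[OF that] assms(1) finite_subset by blast
  qed
  then show ?thesis
    using Js by simp
qed

lemma sep_word_empty [simp]: "sep_word A {} = []"
  using ordered_list_eqI[of "[]" "{}"] by (simp add: sep_word_def sep_classes_def)

lemma sep_word_single:
  assumes "V \<noteq> {}" "finite (\<Union>V)" "\<And>B. B \<in> V \<Longrightarrow> B \<noteq> {}" "\<not> splits A (\<Union>V)"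
  shows "sep_word A V = [Abs_ncp (standardize V)]"
proof -
  have ne: "\<Union>V \<noteq> {}"
    using assms(1,3) by blast
  then have "ordered_list (sep_classes A (\<Union>V)) = [\<Union>V]"
    using assms(2,4) by (intro ordered_list_eqI) (auto simp: sep_classes_single)
  moreover have "{B \<in> V. B \<subseteq> \<Union>V} = V"
    by blast
  ultimately show ?thesis
    by (simp add: sep_word_def)
qed

text \<open>Only separators between two points of the family influence its classes. This lets
  separators on the far side of a cut be added or dropped.\<close>

lemma sep_word_cong:
  assumes "\<And>a x y. x \<in> \<Union>V \<Longrightarrow> y \<in> \<Union>V \<Longrightarrow> x < a \<Longrightarrow> a < y \<Longrightarrow> a \<in> A \<longleftrightarrow> a \<in> A'"
  shows "sep_word A V = sep_word A' V"
proof -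
  have "sep_class A (\<Union>V) x = sep_class A' (\<Union>V) x" if "x \<in> \<Union>V" for x
    using assms that unfolding sep_class_def by blast
  then have "sep_classes A (\<Union>V) = sep_classes A' (\<Union>V)"
    unfolding sep_classes_def by (rule image_cong[OF refl])
  then show ?thesis
    by (simp add: sep_word_def)
qed

lemma sep_word_Un:
  assumes "a \<in> A" "\<And>x. x \<in> \<Union>V1 \<Longrightarrow> x < a" "\<And>x. x \<in> \<Union>V2 \<Longrightarrow> a < x"
    and fin: "finite (\<Union>V1)" "finite (\<Union>V2)" and dis: "A \<inter> \<Union>V1 = {}" "A \<inter> \<Union>V2 = {}"
    and ne: "\<And>B. B \<in> V1 \<union> V2 \<Longrightarrow> B \<noteq> {}"
  shows "sep_word A (V1 \<union> V2) = sep_word A V1 @ sep_word A V2"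
proof -
  let ?l = "\<lambda>V. ordered_list (sep_classes A (\<Union>V))"
  note o1 = ordered_list_sep_classes[OF fin(1) dis(1)]
  note o2 = ordered_list_sep_classes[OF fin(2) dis(2)]
  have un: "sep_classes A (\<Union>(V1 \<union> V2)) = sep_classes A (\<Union>V1) \<union> sep_classes A (\<Union>V2)"
    using sep_classes_Un[OF assms(1-3), of "\<Union>V1" "\<Union>V2"] by simp
  have fs: "finite J \<and> J \<noteq> {}" if "J \<in> sep_classes A (\<Union>(V1 \<union> V2))" for J
    using that fin sep_classes_subset[OF that] sep_classes_nonempty[OF that] finite_subset by fastforce
  have "Max I < Min J" if "I \<in> sep_classes A (\<Union>V1)" "J \<in> sep_classes A (\<Union>V2)" for I J
  proof -
    have "Max I \<in> I" "Min J \<in> J"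
      using fs[of I] fs[of J] un that by auto
    then have "Max I \<in> \<Union>V1" "Min J \<in> \<Union>V2"
      using that sep_classes_subset by blast+
    then have "Max I < a" "a < Min J"
      using assms(2,3) by blast+
    then show ?thesis
      by simp
  qed
  then have "?l (V1 \<union> V2) = ?l V1 @ ?l V2"
    using o1 o2 un fs by (intro ordered_list_eqI) (auto simp: sorted_wrt_append)
  \<comment> \<open>Nonemptiness of blocks enters here: an empty block of \<open>V2\<close> would be
    contained in every class of \<open>V1\<close>.\<close>
  moreover have "{B \<in> V1 \<union> V2. B \<subseteq> J} = {B \<in> V1. B \<subseteq> J}" if "J \<in> set (?l V1)" for J
  proof -
    have "J \<subseteq> \<Union>V1"
      using that o1 sep_classes_subset by blast
    then have "\<not> B \<subseteq> J" if "B \<in> V2" for B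
      using that ne[of B] assms(2,3) by (metis UnCI UnionI equals0I less_asym subsetD)
    then show ?thesis
      by blast
  qed
  moreover have "{B \<in> V1 \<union> V2. B \<subseteq> J} = {B \<in> V2. B \<subseteq> J}" if "J \<in> set (?l V2)" for J
  proof -
    have "J \<subseteq> \<Union>V2"
      using that o2 sep_classes_subset by blast
    then have "\<not> B \<subseteq> J" if "B \<in> V1" for B
      using that ne[of B] assms(2,3) by (metis UnCI UnionI equals0I less_asym subsetD)
    then show ?thesis
      by blast
  qed
  ultimately show ?thesis
    by (simp add: sep_word_def)
qed

section \<open>Separated families and cutting at a separator\<close>

text \<open>The inequalities around \<open>a\<close> are not strict: the instance
  \<open>x = y = a\<close> makes \<open>A\<close> disjoint from \<open>\<Union>V\<close>, so a cut
  at \<open>a\<close> leaves every point on one side.\<close>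

definition separated :: "nat set \<Rightarrow> nat set set \<Rightarrow> bool" where
  "separated A V \<longleftrightarrow> finite V \<and> (\<forall>B\<in>V. finite B \<and> B \<noteq> {}) \<and> disjoint V \<and> noncrossing V \<and>
     (\<forall>B\<in>V. \<forall>a\<in>A. \<forall>x\<in>B. \<forall>y\<in>B. \<not> (x \<le> a \<and> a \<le> y))"

lemma separatedD:
  assumes "separated A V"
  shows "finite V" "finite (\<Union>V)" "\<And>B. B \<in> V \<Longrightarrow> finite B" "\<And>B. B \<in> V \<Longrightarrow> B \<noteq> {}"
    "\<And>B C. B \<in> V \<Longrightarrow> C \<in> V \<Longrightarrow> B \<noteq> C \<Longrightarrow> B \<inter> C = {}" "A \<inter> \<Union>V = {}" "noncrossing V"
    "\<And>B a x y. B \<in> V \<Longrightarrow> a \<in> A \<Longrightarrow> x \<in> B \<Longrightarrow> y \<in> B \<Longrightarrow> x < a \<Longrightarrow> a < y \<Longrightarrow> False"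
proof -
  have *: "finite V" "\<forall>B\<in>V. finite B \<and> B \<noteq> {}" "disjoint V" "noncrossing V"
    "\<forall>B\<in>V. \<forall>a\<in>A. \<forall>x\<in>B. \<forall>y\<in>B. \<not> (x \<le> a \<and> a \<le> y)"
    using assms unfolding separated_def by blast+
  show "finite V" "noncrossing V" "\<And>B. B \<in> V \<Longrightarrow> finite B" "\<And>B. B \<in> V \<Longrightarrow> B \<noteq> {}"
    using * by auto
  show "finite (\<Union>V)"
    using * by (intro finite_Union) auto
  show "B \<inter> C = {}" if "B \<in> V" "C \<in> V" "B \<noteq> C" for B C
    using *(3) that by (rule disjointD)
  show "A \<inter> \<Union>V = {}"
    using *(5) by blast
  show False if "B \<in> V" "a \<in> A" "x \<in> B" "y \<in> B" "x < a" "a < y" for B a x y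
    using *(5) that by (meson less_imp_le)
qed

lemma noncrossingD:
  assumes "noncrossing P" "B \<in> P" "C \<in> P" "B \<noteq> C" "p1 \<in> B" "q1 \<in> C" "p2 \<in> B" "q2 \<in> C"
  shows "\<not> (p1 < q1 \<and> q1 < p2 \<and> p2 < q2)"
proof
  assume "p1 < q1 \<and> q1 < p2 \<and> p2 < q2"
  then have "\<exists>p1\<in>B. \<exists>q1\<in>C. \<exists>p2\<in>B. \<exists>q2\<in>C. p1 < q1 \<and> q1 < p2 \<and> p2 < q2"
    using assms(5-8) by (intro bexI)
  then have "\<not> noncrossing P"
    unfolding noncrossing_def not_not using assms(2-4) by (intro bexI[of _ B] bexI[of _ C] conjI)
  then show False
    using assms(1) by simp
qed

lemma noncrossingI:
  assumes "\<And>B C p1 q1 p2 q2. B \<in> P \<Longrightarrow> C \<in> P \<Longrightarrow> B \<noteq> C \<Longrightarrow> p1 \<in> B \<Longrightarrow> q1 \<in> C \<Longrightarrow> p2 \<in> B \<Longrightarrow>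
    q2 \<in> C \<Longrightarrow> p1 < q1 \<Longrightarrow> q1 < p2 \<Longrightarrow> p2 < q2 \<Longrightarrow> False"
  shows "noncrossing P"
  unfolding noncrossing_def
proof
  assume "\<exists>B\<in>P. \<exists>C\<in>P. B \<noteq> C \<and>
    (\<exists>p1\<in>B. \<exists>q1\<in>C. \<exists>p2\<in>B. \<exists>q2\<in>C. p1 < q1 \<and> q1 < p2 \<and> p2 < q2)"
  then obtain B C p1 q1 p2 q2 where "B \<in> P" "C \<in> P" "B \<noteq> C"
    "p1 \<in> B" "q1 \<in> C" "p2 \<in> B" "q2 \<in> C" "p1 < q1" "q1 < p2" "p2 < q2"
    by (elim bexE conjE) (rule that)
  then show False
    by (rule assms)
qed

lemma separated_mono:
  assumes "separated A V" "W \<subseteq> V" "A' \<subseteq> A"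
  shows "separated A' W"
proof -
  have "noncrossing W"
    using noncrossingD[OF separatedD(7)[OF assms(1)]] assms(2) by (intro noncrossingI) (meson subsetD)
  moreover have "disjoint W"
    using assms unfolding separated_def by (meson pairwise_subset)
  moreover have "finite W"
    using assms unfolding separated_def by (meson finite_subset)
  ultimately show ?thesis
    using assms unfolding separated_def by (meson subsetD)
qed

text \<open>With \<open>Min\<close> and \<open>Max\<close> replaced by quantifiers over points,
  nesting is visibly a matter of order alone and transports along strictly increasing maps.\<close>

lemma nested_iff:
  assumes "finite C" "C \<noteq> {}"
  shows "nested B C \<longleftrightarrow> (\<forall>m\<in>B. (\<exists>c\<in>C. c < m) \<and> (\<exists>c\<in>C. m < c))"
  using assms by (simp add: nested_def Min_less_iff Max_gr_iff)

text \<open>A block of \<open>V - P\<close> straddling a point of \<open>P\<close> would have the whole block of that point nested in it.\<close>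

lemma separated_admissible:
  assumes "separated A V" "P \<in> admissible V"
  shows "separated (A \<union> \<Union>P) (V - P)"
proof -
  have PV: "P \<subseteq> V"
    using assms(2) by (auto simp: admissible_def)
  have s: "separated A (V - P)"
    using separated_mono[OF assms(1)] by blast
  have straddle: "\<not> (x \<le> a \<and> a \<le> y)" if B: "B \<in> V - P" "a \<in> C" "C \<in> P" "x \<in> B" "y \<in> B" for B C a x y
  proof
    assume xy: "x \<le> a \<and> a \<le> y"
    have BC: "B \<in> V" "C \<in> V" "B \<noteq> C" "B \<inter> C = {}"
      using B PV separatedD(5)[OF assms(1)] by blast+
    then have xa: "x < a" "a < y"
      using xy B by (metis IntI empty_iff le_neq_implies_less)+
    note nc = noncrossingD[OF separatedD(7)[OF assms(1)]]
    have "x < m \<and> m < y" if "m \<in> C" for m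
    proof -
      have "m \<noteq> x" "m \<noteq> y"
        using that BC B by blast+
      moreover have "\<not> m < x"
        using nc[OF BC(2,1) BC(3)[symmetric] that \<open>x \<in> B\<close> \<open>a \<in> C\<close> \<open>y \<in> B\<close>] xa by simp
      moreover have "\<not> y < m"
        using nc[OF BC(1-3) \<open>x \<in> B\<close> \<open>a \<in> C\<close> \<open>y \<in> B\<close> that] xa by simp
      ultimately show ?thesis
        by simp
    qed
    then have "nested C B"
      using B BC separatedD(3,4)[OF assms(1)] by (subst nested_iff) blast+
    then show False
      using assms(2) B by (auto simp: admissible_def)
  qed
  have "\<not> (x \<le> a \<and> a \<le> y)" if "B \<in> V - P" "a \<in> A \<union> \<Union>P" "x \<in> B" "y \<in> B" for B a x y
    using that(2)
  proof
    assume "a \<in> A"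
    then show ?thesis
      using s that unfolding separated_def by meson
  next
    assume "a \<in> \<Union>P"
    then show ?thesis
      using straddle that by (meson UnionE)
  qed
  then show ?thesis
    using s unfolding separated_def by meson
qed

text \<open>In effect an induction on the number of letters: a nonempty family that no separator
  splits is one letter, and a cut at a separator is a concatenation. Each block lies on one side of
  \<open>a\<close>, because \<open>a\<close> neither belongs to it nor has points of it on both
  sides; both sides are nonempty, hence strictly smaller.\<close>

lemma separated_induct [consumes 1, case_names empty single Un]:
  assumes "separated A V"
    and "P {}"
    and "\<And>V. separated A V \<Longrightarrow> V \<noteq> {} \<Longrightarrow> \<not> splits A (\<Union>V) \<Longrightarrow> P V"
    and "\<And>a V1 V2. separated A (V1 \<union> V2) \<Longrightarrow> a \<in> A \<Longrightarrow> V1 \<noteq> {} \<Longrightarrow> V2 \<noteq> {} \<Longrightarrow>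
      (\<And>x. x \<in> \<Union>V1 \<Longrightarrow> x < a) \<Longrightarrow> (\<And>x. x \<in> \<Union>V2 \<Longrightarrow> a < x) \<Longrightarrow> P V1 \<Longrightarrow> P V2 \<Longrightarrow> P (V1 \<union> V2)"
  shows "P V"
proof -
  have "finite V"
    using assms(1) by (rule separatedD)
  then show ?thesis
    using assms(1)
  proof (induction V rule: finite_psubset_induct)
    case (psubset V)
    consider "V = {}" | "V \<noteq> {}" "\<not> splits A (\<Union>V)" | "splits A (\<Union>V)"
      by blast
    then show ?case
    proof cases
      case 1
      then show ?thesis using assms(2) by simp
    next
      case 2
      then show ?thesis using assms(3) psubset.prems by blast
    next
      case 3
      then obtain a x y B C where a: "a \<in> A" "x \<in> B" "y \<in> C" "B \<in> V" "C \<in> V" "x < a" "a < y"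
        by (auto simp: splits_def)
      define V1 where "V1 = {B \<in> V. \<forall>x\<in>B. x < a}"
      define V2 where "V2 = {B \<in> V. \<forall>x\<in>B. a < x}"
      note D = separatedD[OF psubset.prems]
      have dich: "(\<forall>x\<in>D. x < a) \<or> (\<forall>x\<in>D. a < x)" if "D \<in> V" for D
        using D(8)[OF that a(1)] D(6) a(1) that by (metis IntI UnionI empty_iff linorder_neqE_nat)
      then have V: "V = V1 \<union> V2"
        by (auto simp: V1_def V2_def)
      have B: "B \<in> V1" "B \<notin> V2" and C: "C \<in> V2" "C \<notin> V1"
        using a dich[of B] dich[of C] unfolding V1_def V2_def by (blast dest: less_asym)+
      then have sub: "V1 \<subset> V" "V2 \<subset> V"
        using V a by blast+
      then have "P V1" "P V2"
        using psubset.IH separated_mono[OF psubset.prems] by blast+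
      then show ?thesis
        unfolding V
      proof (intro assms(4)[OF _ a(1)])
        show "separated A (V1 \<union> V2)"
          using V psubset.prems by metis
        show "V1 \<noteq> {}" "V2 \<noteq> {}"
          using B C by blast+
      qed (auto simp: V1_def V2_def)
    qed
  qed
qed

lemma sep_word_Un_separated:
  assumes "separated A (V1 \<union> V2)" "a \<in> A" "\<And>x. x \<in> \<Union>V1 \<Longrightarrow> x < a" "\<And>x. x \<in> \<Union>V2 \<Longrightarrow> a < x"
  shows "sep_word A (V1 \<union> V2) = sep_word A V1 @ sep_word A V2"
proof (rule sep_word_Un[OF assms(2)])
  note D = separatedD[OF assms(1)]
  show "finite (\<Union>V1)" "finite (\<Union>V2)" "A \<inter> \<Union>V1 = {}" "A \<inter> \<Union>V2 = {}"
    using D(2,6) by (simp_all add: Int_Un_distrib)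
  show "B \<noteq> {}" if "B \<in> V1 \<union> V2" for B
    using D(4) that .
qed (fact assms(3,4))+

text \<open>Identifies the terms of the coproduct with a trivial factor, which is what the counit
  and the augmentation ideal detect.\<close>

lemma sep_word_eq_Nil_iff:
  assumes "separated A V"
  shows "sep_word A V = [] \<longleftrightarrow> V = {}"
  using assms
proof (induction rule: separated_induct)
  case empty
  then show ?case by simp
next
  case (single V)
  then show ?case
    using sep_word_single[of V A] separatedD[OF single(1)] by simp
next
  case (Un a V1 V2)
  then show ?case
    using sep_word_Un_separated[OF Un(1,2)] by simp
qed

section \<open>Invariance under strictly increasing relabellings\<close>

text \<open>The rank of a point counts the points up to it, and a strictly increasing map preserves
  this count.\<close>

lemma st_image:
  assumes "strict_mono_on S f" "x \<in> S"
  shows "st (f ` S) (f x) = st S x"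
proof -
  have "f y \<le> f x \<longleftrightarrow> y \<le> x" if "y \<in> S" for y
    using strict_mono_on_less_eq[OF assms(1) that assms(2)] .
  then have "{y \<in> f ` S. y \<le> f x} = f ` {y \<in> S. y \<le> x}"
    by auto
  moreover have "inj_on f {y \<in> S. y \<le> x}"
    using strict_mono_on_imp_inj_on[OF assms(1)] by (rule inj_on_subset) auto
  ultimately show ?thesis
    by (simp add: st_def card_image)
qed

lemma standardize_image:
  assumes "strict_mono_on (\<Union>V) f"
  shows "standardize ((`) f ` V) = standardize V"
proof -
  have "\<Union>((`) f ` V) = f ` \<Union>V"
    by blast
  moreover have "st (f ` \<Union>V) ` f ` B = st (\<Union>V) ` B" if "B \<in> V" for B
    unfolding image_image using that by (intro image_cong) (auto intro: st_image[OF assms])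
  ultimately show ?thesis
    by (simp add: standardize_def image_image)
qed

text \<open>A word depends only on the relative order of separators and points, so \<open>f\<close>
  has to be strictly increasing on a set \<open>S\<close> that contains both. It serves to undo a
  standardization and to shift a letter to the right.\<close>

lemma sep_word_image:
  assumes "separated A V" "strict_mono_on S f" "A \<subseteq> S" "\<Union>V \<subseteq> S"
  shows "sep_word (f ` A) ((`) f ` V) = sep_word A V"
  using assms(1,4)
proof (induction rule: separated_induct)
  case empty
  then show ?case by simp
next
  case (single V)
  have U: "\<Union>((`) f ` V) = f ` \<Union>V"
    by blast
  have ns: "\<not> splits (f ` A) (f ` \<Union>V)"
  proof
    assume "splits (f ` A) (f ` \<Union>V)"
    then obtain a x y where *: "a \<in> A" "x \<in> \<Union>V" "y \<in> \<Union>V" "f x < f a" "f a < f y"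
      unfolding splits_def by (elim bexE conjE imageE) simp
    then have "a \<in> S" "x \<in> S" "y \<in> S"
      using assms(3) single(4) by blast+
    then have "x < a" "a < y"
      using * strict_mono_on_less[OF assms(2)] by blast+
    then show False
      using * single(3) unfolding splits_def by blast
  qed
  note D = separatedD[OF single(1)]
  have "sep_word (f ` A) ((`) f ` V) = [Abs_ncp (standardize ((`) f ` V))]"
    using ns D single(2) unfolding U[symmetric] by (intro sep_word_single) (auto simp: U)
  also have "standardize ((`) f ` V) = standardize V"
    using assms(2) single(4) by (intro standardize_image) (meson monotone_on_subset)
  also have "[Abs_ncp (standardize V)] = sep_word A V"
    using D single by (intro sep_word_single[symmetric]) auto
  finally show ?case .
next
  case (Un a V1 V2)
  have U: "\<Union>((`) f ` V) = f ` \<Union>V" for V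
    by blast
  note D = separatedD[OF Un(1)]
  have inj: "inj_on f S"
    using strict_mono_on_imp_inj_on[OF assms(2)] .
  have "f ` A \<inter> f ` \<Union>(V1 \<union> V2) = f ` (A \<inter> \<Union>(V1 \<union> V2))"
    using inj_on_image_Int[OF inj assms(3) Un(9)] by simp
  then have dis: "f ` A \<inter> f ` \<Union>(V1 \<union> V2) = {}"
    using D(6) by simp
  have "sep_word (f ` A) ((`) f ` V1 \<union> (`) f ` V2)
      = sep_word (f ` A) ((`) f ` V1) @ sep_word (f ` A) ((`) f ` V2)"
  proof (rule sep_word_Un)
    show "f a \<in> f ` A"
      using Un by simp
    show "x < f a" if x: "x \<in> \<Union>((`) f ` V1)" for x
    proof -
      obtain y where "y \<in> \<Union>V1" "x = f y"
        using x unfolding U by blast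
      then show ?thesis
        using Un(2,5,9) assms(3) by (auto intro!: strict_mono_onD[OF assms(2)])
    qed
    show "f a < x" if x: "x \<in> \<Union>((`) f ` V2)" for x
    proof -
      obtain y where "y \<in> \<Union>V2" "x = f y"
        using x unfolding U by blast
      then show ?thesis
        using Un(2,6,9) assms(3) by (auto intro!: strict_mono_onD[OF assms(2)])
    qed
    show "finite (\<Union>((`) f ` V1))" "finite (\<Union>((`) f ` V2))"
      using D(2) unfolding U by simp_all
    show "f ` A \<inter> \<Union>((`) f ` V1) = {}" "f ` A \<inter> \<Union>((`) f ` V2) = {}"
      using dis unfolding U by blast+
    show "B \<noteq> {}" if "B \<in> (`) f ` V1 \<union> (`) f ` V2" for B
      using that D(4) by blast
  qed
  then show ?case
    using Un sep_word_Un_separated[OF Un(1,2)] by (simp add: image_Un)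
qed

text \<open>Nesting is an order condition, and injectivity on blocks turns complements into
  complements, so both ingredients of admissibility are preserved.\<close>

lemma admissible_image:
  assumes "separated A V" "strict_mono_on (\<Union>V) f"
  shows "admissible ((`) f ` V) = (`) ((`) f) ` admissible V" and "inj_on ((`) f) V"
proof -
  note D = separatedD[OF assms(1)]
  have inj: "inj_on f (\<Union>V)"
    using strict_mono_on_imp_inj_on[OF assms(2)] .
  show injV: "inj_on ((`) f) V"
    using inj by (intro inj_onI) (metis Union_upper inj_on_image_eq_iff)
  have nest: "nested (f ` B) (f ` C) \<longleftrightarrow> nested B C" if "B \<in> V" "C \<in> V" for B C
  proof -
    have "f x < f y \<longleftrightarrow> x < y" if "x \<in> B \<union> C" "y \<in> B \<union> C" for x y
      using strict_mono_on_less[OF assms(2)] that \<open>B \<in> V\<close> \<open>C \<in> V\<close> by blast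
    then show ?thesis
      using D(3,4)[of C] that by (simp add: nested_iff)
  qed
  have adm: "(`) f ` R \<in> admissible ((`) f ` V) \<longleftrightarrow> R \<in> admissible V" if "R \<subseteq> V" for R
  proof -
    have "(`) f ` V - (`) f ` R = (`) f ` (V - R)"
      using inj_on_image_set_diff[OF injV, of V R] that by simp
    then show ?thesis
      using that nest by (auto simp: admissible_def) (meson DiffI subsetD)+
  qed
  show "admissible ((`) f ` V) = (`) ((`) f) ` admissible V"
  proof (intro equalityI subsetI)
    fix Q assume Q: "Q \<in> admissible ((`) f ` V)"
    then have "Q \<subseteq> (`) f ` V"
      by (auto simp: admissible_def)
    then obtain R where "R \<subseteq> V" "Q = (`) f ` R"
      by (meson subset_imageE)
    then show "Q \<in> (`) ((`) f) ` admissible V"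
      using adm Q by auto
  next
    fix Q assume "Q \<in> (`) ((`) f) ` admissible V"
    then obtain R where R: "R \<in> admissible V" "Q = (`) f ` R"
      by auto
    then have "R \<subseteq> V" by (auto simp: admissible_def)
    then show "Q \<in> admissible ((`) f ` V)"
      using adm R by auto
  qed
qed

section \<open>Maximal runs and the least point in terms of separators\<close>

text \<open>The ambient set \<open>{1..n}\<close> is an interval, so its only holes are the elements
  of \<open>A\<close>; two remaining points share a run exactly when no hole lies between
  them.\<close>

lemma max_runs_eq_sep_classes:
  assumes "A \<subseteq> {1..n}"
  shows "max_runs ({1..n} - A) = sep_classes A ({1..n} - A)"
proof (intro equalityI subsetI)
  let ?S = "{1..n} - A"
  fix J assume J: "J \<in> max_runs ?S"
  then obtain a b where ab: "a \<le> b" "J = {a..b}" "J \<subseteq> ?S"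
    by (auto simp: max_runs_def is_run_def)
  have max: "J' = J" if "is_run J'" "J \<subseteq> J'" "J' \<subseteq> ?S" for J'
    using J that by (auto simp: max_runs_def)
  have "y \<in> J" if y: "y \<in> sep_class A ?S a" for y
  proof -
    \<comment> \<open>The interval spanned by \<open>J\<close> and \<open>y\<close> is again a run
      in \<open>?S\<close>: a point of it outside \<open>J\<close> and different from
      \<open>y\<close> lies strictly between \<open>a\<close> and \<open>y\<close>, where the class
      of \<open>a\<close> allows no element of \<open>A\<close>. Maximality of \<open>J\<close> then
      puts \<open>y\<close> into \<open>J\<close>.\<close>
    have "{min a y..max b y} = J"
    proof (rule max)
      show "is_run {min a y..max b y}"
        unfolding is_run_def using ab by (intro exI[of _ "min a y"] exI[of _ "max b y"]) auto
      show "J \<subseteq> {min a y..max b y}"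
        using ab by auto
      show "{min a y..max b y} \<subseteq> ?S"
      proof
        fix z assume z: "z \<in> {min a y..max b y}"
        have yS: "y \<in> ?S" using y by (auto simp: sep_class_def)
        consider "z \<in> J" | "z = y" | "y < z" "z < a" | "a < z" "z < y"
          using z ab by (auto simp: min_def max_def split: if_splits) linarith+
        then show "z \<in> ?S"
        proof cases
          case 3
          then show ?thesis using y yS ab by (fastforce simp: sep_class_def)
        next
          case 4
          then show ?thesis using y yS ab by (fastforce simp: sep_class_def)
        qed (use ab yS in auto)
      qed
    qed
    then show ?thesis
      using ab by (metis atLeastAtMost_iff max.cobounded2 min.cobounded2)
  qed
  moreover have "J \<subseteq> sep_class A ?S a"
    using ab by (auto simp: sep_class_def)
  ultimately have "J = sep_class A ?S a"
    by blast
  moreover have "a \<in> ?S"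
    using ab by auto
  ultimately show "J \<in> sep_classes A ?S"
    unfolding sep_classes_def by blast
next
  let ?S = "{1..n} - A"
  fix J assume "J \<in> sep_classes A ?S"
  then obtain x where x: "x \<in> ?S" "J = sep_class A ?S x"
    by (auto simp: sep_classes_def)
  have xJ: "x \<in> J" and JS: "J \<subseteq> ?S" and fin: "finite J"
    using x by (auto simp: sep_class_def)
  \<comment> \<open>A hole between the two extremes of a class would separate one of them from
    \<open>x\<close>, or be \<open>x\<close> itself, which is not in \<open>A\<close>.\<close>
  have "J = {Min J..Max J}"
  proof (intro equalityI subsetI)
    fix z assume "z \<in> J"
    then show "z \<in> {Min J..Max J}"
      using fin by auto
  next
    fix z assume z: "z \<in> {Min J..Max J}"
    have m: "Min J \<in> J" "Max J \<in> J"
      using fin xJ by (auto intro: Min_in Max_in)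
    have "z \<in> {1..n}"
      using z subsetD[OF JS m(1)] subsetD[OF JS m(2)] by simp
    show "z \<in> J"
    proof (cases "z = x \<or> z = Min J \<or> z = Max J")
      case True
      then show ?thesis using m xJ by auto
    next
      case False
      then have "Min J < z" "z < Max J"
        using z by auto
      have between: "\<not> (x < a \<and> a < y) \<and> \<not> (y < a \<and> a < x)" if "y \<in> J" "a \<in> A" for a y
        using that x by (auto simp: sep_class_def)
      have "z \<notin> A"
        using between[OF m(1)] between[OF m(2)] \<open>Min J < z\<close> \<open>z < Max J\<close> False
        by (metis linorder_neqE_nat)
      moreover have "\<not> (x < a \<and> a < z) \<and> \<not> (z < a \<and> a < x)" if "a \<in> A" for a
        using between[OF m(1) that] between[OF m(2) that] \<open>Min J < z\<close> \<open>z < Max J\<close> by linarith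
      ultimately show ?thesis
        using x \<open>z \<in> {1..n}\<close> by (auto simp: sep_class_def)
    qed
  qed
  then have "is_run J"
    unfolding is_run_def using fin xJ by (metis Max_ge Min_le order_trans)
  moreover have "J' = J" if J': "is_run J'" "J \<subseteq> J'" "J' \<subseteq> ?S" for J'
  proof -
    obtain c d where cd: "J' = {c..d}"
      using J'(1) by (auto simp: is_run_def)
    have "y \<in> J" if "y \<in> J'" for y
    proof -
      have "a \<notin> A" if "x < a \<and> a < y \<or> y < a \<and> a < x" for a
      proof -
        have "a \<in> J'" using that \<open>y \<in> J'\<close> xJ J'(2) cd by auto
        then show ?thesis using J'(3) by auto
      qed
      then show ?thesis
        using x that J'(3) by (auto simp: sep_class_def)
    qed
    then show ?thesis
      using J'(2) by blast
  qed
  ultimately show "J \<in> max_runs ?S"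
    using JS by (auto simp: max_runs_def)
qed

lemma NC_separated:
  assumes "L \<in> NC n"
  shows "separated {} L"
proof -
  have p: "partition_on {1..n} L" and "noncrossing L"
    using assms by (auto simp: NC_def)
  moreover have "finite L"
    using p finite_elements by blast
  moreover have "finite B \<and> B \<noteq> {}" if "B \<in> L" for B
    using p that by (metis finite_atLeastAtMost finite_subset partition_onD1 partition_onD3 Sup_upper)
  ultimately show ?thesis
    by (auto simp: separated_def partition_on_def)
qed

text \<open>The blocks of \<open>L\<close> fill \<open>{1..n}\<close>, so the points missing from
  the complement of \<open>Q\<close> are exactly those of \<open>\<Union>Q\<close>; the removed
  points act as separators.\<close>

lemma pieces_eq_sep_word:
  assumes "L \<in> NC n" "Q \<subseteq> L"
  shows "pieces L Q = sep_word (\<Union>Q) (L - Q)"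
proof -
  have U: "\<Union>L = {1..n}"
    using assms(1) by (auto simp: NC_def partition_on_def)
  note D = separatedD[OF NC_separated[OF assms(1)]]
  have "\<Union>(L - Q) = \<Union>L - \<Union>Q"
    using D(5) assms(2) by blast
  moreover have "max_runs (\<Union>L - \<Union>Q) = sep_classes (\<Union>Q) (\<Union>L - \<Union>Q)"
    unfolding U using U assms(2) by (intro max_runs_eq_sep_classes) blast
  ultimately show ?thesis
    by (simp add: pieces_def sep_word_def max_run_list_def ordered_list_def)
qed

lemma st_word_eq_sep_word:
  assumes "separated {} Q"
  shows "st_word Q = sep_word {} Q"
  using sep_word_single[of Q "{}"] separatedD[OF assms] by (auto simp: st_word_def splits_def)

lemma blocks_Abs_ncp_standardize:
  assumes "separated A V" "V \<noteq> {}"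
  shows "blocks (Abs_ncp (standardize V)) = standardize V"
    and "standardize V \<in> NC (card (\<Union>V))"
proof -
  note D = separatedD[OF assms(1)]
  have "partition_on (\<Union>V) V"
    using D(4) assms(1) by (auto simp: partition_on_def separated_def)
  then show *: "standardize V \<in> NC (card (\<Union>V))"
    using D by (intro standardize_NC) auto
  have "\<Union>V \<noteq> {}"
    using assms(2) D(4) by blast
  then have "card (\<Union>V) \<ge> 1"
    using D(2) by (simp add: Suc_le_eq card_gt_0_iff)
  then show "blocks (Abs_ncp (standardize V)) = standardize V"
    using * by (intro Abs_ncp_inverse) auto
qed

text \<open>Translates the distinguished point 1 of a standardized letter into the least point of
  the original family.\<close>

lemma st_eq_1_iff:
  assumes "finite S" "x \<in> S"
  shows "st S x = 1 \<longleftrightarrow> x = Min S"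
proof
  assume "x = Min S"
  then have "{y \<in> S. y \<le> x} = {x}"
    using assms by (auto intro: antisym)
  then show "st S x = 1"
    by (simp add: st_def)
next
  assume "st S x = 1"
  then obtain z where z: "{y \<in> S. y \<le> x} = {z}"
    unfolding st_def by (metis card_1_singletonE)
  have "Min S \<in> {y \<in> S. y \<le> x}" "x \<in> {y \<in> S. y \<le> x}"
    using assms Min_in[of S] Min_le[of S x] by fastforce+
  then show "x = Min S"
    using z by auto
qed

lemma standardize_NC_self:
  assumes "L \<in> NC n"
  shows "standardize L = L"
proof -
  have U: "\<Union>L = {1..n}"
    using assms by (auto simp: NC_def partition_on_def)
  have self: "st {1..n} x = x" if "x \<in> {1..n}" for x
  proof -
    have "{y \<in> {1..n}. y \<le> x} = {1..x}"
      using that by auto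
    then show ?thesis
      by (simp add: st_def)
  qed
  have "st (\<Union>L) ` B = B" if "B \<in> L" for B
  proof -
    have "B \<subseteq> {1..n}"
      using that U by blast
    then have "st {1..n} ` B = (\<lambda>x. x) ` B"
      using self by (intro image_cong) auto
    then show ?thesis
      using U by simp
  qed
  then show ?thesis
    by (simp add: standardize_def)
qed

text \<open>A translate of the last letter is placed to the right of a family for the preceding
  letters, with one new separator in between. Finiteness of \<open>A\<close> is carried along so
  that a position beyond everything is available.\<close>

lemma exists_sep_word: "\<exists>A V. separated A V \<and> finite A \<and> sep_word A V = w"
proof (induction w rule: rev_induct)
  case Nil
  show ?case
    by (intro exI[of _ "{}"]) (simp add: separated_def noncrossing_def)
next
  case (snoc L w)
  then obtain A V where AV: "separated A V" "finite A" "sep_word A V = w"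
    by blast
  note D = separatedD[OF AV(1)]
  obtain n where n: "n \<ge> 1" "blocks L \<in> NC n"
    using blocks[of L] by auto
  have U: "\<Union>(blocks L) = {1..n}"
    using n by (auto simp: NC_def partition_on_def)
  note sL = NC_separated[OF n(2)]
  note DL = separatedD[OF sL]
  \<comment> \<open>\<open>N\<close> exceeds all earlier separators and points; inserting 0 covers
    the case that there are none. The points of a letter are at least 1, so the shift by
    \<open>N\<close> moves them strictly beyond \<open>N\<close>, which becomes the new
    separator.\<close>
  define N where "N = Suc (Max (insert 0 (A \<union> \<Union>V)))"
  have N: "x < N" if "x \<in> A \<union> \<Union>V" for x
    using that AV(2) D(2) by (auto simp: N_def less_Suc_eq_le intro!: Max_ge)
  define V2 where "V2 = (`) (\<lambda>x. x + N) ` blocks L"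
  have N2: "N < x" if "x \<in> \<Union>V2" for x
  proof -
    obtain y where "x = y + N" "y \<in> \<Union>(blocks L)"
      using \<open>x \<in> \<Union>V2\<close> by (auto simp: V2_def)
    then show ?thesis using U by auto
  qed
  have ne2: "finite B" "B \<noteq> {}" if "B \<in> V2" for B
    using that DL(3,4) by (auto simp: V2_def)
  have fin2: "finite V2" "blocks L \<noteq> {}"
    using DL(1) U n(1) by (auto simp: V2_def)
  have dis2: "B \<inter> C = {}" if BC: "B \<in> V2" "C \<in> V2" "B \<noteq> C" for B C
  proof -
    obtain B' C' where "B' \<in> blocks L" "C' \<in> blocks L" "B = (\<lambda>x. x + N) ` B'" "C = (\<lambda>x. x + N) ` C'"
      using BC(1,2) unfolding V2_def by (elim imageE) simp
    then show ?thesis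
      using DL(5)[of B' C'] BC(3) by (cases "B' = C'") auto
  qed
  have nc2: "noncrossing V2"
  proof -
    have False if *: "B \<in> blocks L" "C \<in> blocks L" "(\<lambda>x. x + N) ` B \<noteq> (\<lambda>x. x + N) ` C"
      "p1 \<in> (\<lambda>x. x + N) ` B" "q1 \<in> (\<lambda>x. x + N) ` C" "p2 \<in> (\<lambda>x. x + N) ` B"
      "q2 \<in> (\<lambda>x. x + N) ` C" "p1 < q1" "q1 < p2" "p2 < q2" for B C p1 q1 p2 q2
    proof -
      obtain r1 where r1: "p1 = r1 + N" "r1 \<in> B" using *(4) by blast
      obtain s1 where s1: "q1 = s1 + N" "s1 \<in> C" using *(5) by blast
      obtain r2 where r2: "p2 = r2 + N" "r2 \<in> B" using *(6) by blast
      obtain s2 where s2: "q2 = s2 + N" "s2 \<in> C" using *(7) by blast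
      have "B \<noteq> C" using *(3) by metis
      then show False
        using noncrossingD[OF DL(7) *(1,2) _ r1(2) s1(2) r2(2) s2(2)] *(8-10) r1 s1 r2 s2 by simp
    qed
    then show ?thesis
      unfolding V2_def by (intro noncrossingI) (elim imageE, simp only:)
  qed
  have "separated (insert N A) (V \<union> V2)"
    unfolding separated_def
  proof (intro conjI)
    show "finite (V \<union> V2)" "\<forall>B\<in>V \<union> V2. finite B \<and> B \<noteq> {}"
      using D(1,3,4) fin2 ne2 by auto
    have cross: "B \<inter> C = {}" if "B \<in> V" "C \<in> V2" for B C
    proof -
      have "B \<subseteq> {..<N}" "C \<subseteq> {N<..}"
        using that N N2 by auto
      then show ?thesis
        by fastforce
    qed
    show "disjoint (V \<union> V2)"
    proof (rule disjointI)
      fix B C assume "B \<in> V \<union> V2" "C \<in> V \<union> V2" "B \<noteq> C"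
      then show "B \<inter> C = {}"
        using D(5)[of B C] dis2[of B C] cross[of B C] cross[of C B] by (auto simp: Int_commute)
    qed
    show "noncrossing (V \<union> V2)"
    proof (rule noncrossingI)
      fix B C p1 q1 p2 q2 assume *: "B \<in> V \<union> V2" "C \<in> V \<union> V2" "B \<noteq> C" "p1 \<in> B" "q1 \<in> C" "p2 \<in> B"
        "q2 \<in> C" "p1 < q1" "q1 < p2" "p2 < q2"
      then consider "B \<in> V" "C \<in> V" | "B \<in> V2" "C \<in> V2" | "B \<in> V" "C \<in> V2" | "B \<in> V2" "C \<in> V"
        by blast
      then show False
      proof cases
        case 1
        then show ?thesis using noncrossingD[OF D(7) _ _ *(3-7)] * by blast
      next
        case 2
        then show ?thesis using noncrossingD[OF nc2 _ _ *(3-7)] * by blast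
      next
        case 3
        then have "p2 < N" "N < q1" using N[of p2] N2[of q1] * by blast+
        then show ?thesis using * by simp
      next
        case 4
        then have "q1 < N" "N < p1" using N[of q1] N2[of p1] * by blast+
        then show ?thesis using * by simp
      qed
    qed
    show "\<forall>B\<in>V \<union> V2. \<forall>a\<in>insert N A. \<forall>x\<in>B. \<forall>y\<in>B. \<not> (x \<le> a \<and> a \<le> y)"
    proof (intro ballI notI)
      fix B a x y assume *: "B \<in> V \<union> V2" "a \<in> insert N A" "x \<in> B" "y \<in> B" "x \<le> a \<and> a \<le> y"
      show False
      proof (cases "B \<in> V")
        case True
        then have "y < N" using N[of y] * by blast
        then have "a \<in> A" using * by auto
        then show ?thesis using AV(1) True *(3-5) unfolding separated_def by meson
      next
        case False
        then have "N < x" using N2[of x] * by blast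
        moreover have "a \<le> N" using N[of a] * by auto
        ultimately show ?thesis using * by simp
      qed
    qed
  qed
  note sep = this
  have "sep_word (insert N A) (V \<union> V2) = sep_word (insert N A) V @ sep_word (insert N A) V2"
    using N N2 by (intro sep_word_Un_separated[OF sep, of N]) auto
  moreover have "sep_word (insert N A) V = sep_word A V"
  proof (rule sep_word_cong)
    fix a x y assume "x \<in> \<Union>V" "y \<in> \<Union>V" "x < a" "a < y"
    then have "a < N" using N[of y] by simp
    then show "a \<in> insert N A \<longleftrightarrow> a \<in> A" by simp
  qed
  moreover have "sep_word (insert N A) V2 = sep_word {} V2"
  proof (rule sep_word_cong)
    fix a x y assume "x \<in> \<Union>V2" "y \<in> \<Union>V2" "x < a" "a < y"
    then have "N < a" using N2[of x] by simp
    then show "a \<in> insert N A \<longleftrightarrow> a \<in> {}" using N[of a] by auto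
  qed
  moreover have "sep_word {} V2 = sep_word {} (blocks L)"
    using sep_word_image[OF sL, of UNIV "\<lambda>x. x + N"]
    by (simp add: V2_def strict_mono_on_def)
  moreover have "sep_word {} (blocks L) = [Abs_ncp (standardize (blocks L))]"
    using DL fin2 by (intro sep_word_single) (auto simp: splits_def)
  ultimately have "sep_word (insert N A) (V \<union> V2) = w @ [L]"
    using AV(3) standardize_NC_self[OF n(2)] by (simp add: blocks_inverse)
  then show ?case
    using sep AV(2) by blast
qed

section \<open>Linear maps in terms of bases\<close>

lemma lookup_vscale [simp]: "Poly_Mapping.lookup (vscale c x) b = c * Poly_Mapping.lookup x b"
  by (simp add: vscale_def map.rep_eq when_def)

interpretation vs: vector_space "vscale :: 'k::field \<Rightarrow> ('b \<Rightarrow>\<^sub>0 'k) \<Rightarrow> ('b \<Rightarrow>\<^sub>0 'k)"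
  by (rule vector_space_vscale)

abbreviation lin :: "(('b \<Rightarrow>\<^sub>0 'k::field) \<Rightarrow> ('c \<Rightarrow>\<^sub>0 'k)) \<Rightarrow> bool" where
  "lin \<equiv> Vector_Spaces.linear vscale vscale"

lemma linI:
  assumes "\<And>x y. f (x + y) = f x + f y" "\<And>c x. f (vscale c x) = vscale c (f x)"
  shows "lin f"
  unfolding Vector_Spaces.linear_iff by (intro conjI allI vector_space_vscale assms)

lemma linD:
  assumes "lin f"
  shows "f (x + y) = f x + f y" "f (x - y) = f x - f y" "f (vscale c x) = vscale c (f x)" "f 0 = 0"
    "f (sum g I) = (\<Sum>i\<in>I. f (g i))"
proof -
  interpret f: Vector_Spaces.linear vscale vscale f
    by (fact assms)
  show "f (x + y) = f x + f y" "f (x - y) = f x - f y" "f (vscale c x) = vscale c (f x)" "f 0 = 0"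
    "f (sum g I) = (\<Sum>i\<in>I. f (g i))"
    by (rule f.add f.diff f.scale f.zero f.sum)+
qed

text \<open>Allows sums for vectors with different supports to be taken over one common index
  set.\<close>

lemma lin_ext_superset:
  assumes "finite S" "Poly_Mapping.keys x \<subseteq> S"
  shows "lin_ext f x = (\<Sum>b\<in>S. vscale (Poly_Mapping.lookup x b) (f b))"
  unfolding lin_ext_def using assms by (intro sum.mono_neutral_left) (auto simp: in_keys_iff)

lemma lin_lin_ext:
  fixes f :: "'b \<Rightarrow> ('c \<Rightarrow>\<^sub>0 'k::field)"
  shows "lin (lin_ext f)"
proof (rule linI)
  fix x y :: "'b \<Rightarrow>\<^sub>0 'k" and c
  let ?S = "Poly_Mapping.keys x \<union> Poly_Mapping.keys y"
  have "Poly_Mapping.keys (x + y) \<subseteq> ?S"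
    by (rule keys_add)
  then show "lin_ext f (x + y) = lin_ext f x + lin_ext f y"
    by (simp add: lin_ext_superset[of ?S] lookup_add vs.scale_left_distrib sum.distrib)
  have "Poly_Mapping.keys (vscale c x) \<subseteq> Poly_Mapping.keys x"
    by (auto simp: in_keys_iff)
  then show "lin_ext f (vscale c x) = vscale c (lin_ext f x)"
    by (simp add: lin_ext_superset[of "Poly_Mapping.keys x"] vs.scale_sum_right)
qed

lemma keys_basis_vec [simp]: "Poly_Mapping.keys (basis_vec b :: 'b \<Rightarrow>\<^sub>0 'k::field) = {b}"
  by (simp add: basis_vec_def)

lemma lookup_basis_vec: "Poly_Mapping.lookup (basis_vec b) c = (if b = c then 1 else 0)"
  by (simp add: basis_vec_def lookup_single when_def)

lemma lin_ext_basis_vec [simp]: "lin_ext f (basis_vec b) = f b"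
  by (simp add: lin_ext_def lookup_basis_vec)

lemma lin_ext_basis_vec_self: "lin_ext basis_vec x = x"
proof (rule poly_mapping_eqI)
  fix c
  show "Poly_Mapping.lookup (lin_ext basis_vec x) c = Poly_Mapping.lookup x c"
    by (simp add: lin_ext_def lookup_sum lookup_basis_vec in_keys_iff if_distrib cong: if_cong)
qed

lemma lin_eq_lin_ext:
  assumes "lin f"
  shows "f x = lin_ext (\<lambda>b. f (basis_vec b)) x"
proof -
  have "f x = f (lin_ext basis_vec x)"
    by (simp add: lin_ext_basis_vec_self)
  also have "\<dots> = lin_ext (\<lambda>b. f (basis_vec b)) x"
    by (simp add: lin_ext_def linD[OF assms])
  finally show ?thesis .
qed

text \<open>Only basis vectors in the support of \<open>x\<close> are tested; for an element of
  \<open>T_plus\<close> these are the nonempty words.\<close>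

lemma lin_eqI:
  assumes "lin f" "lin g" "\<And>b. b \<in> Poly_Mapping.keys x \<Longrightarrow> f (basis_vec b) = g (basis_vec b)"
  shows "f x = g x"
  unfolding lin_eq_lin_ext[OF assms(1), of x] lin_eq_lin_ext[OF assms(2), of x]
  using assms(3) by (simp add: lin_ext_def)

lemma lin_id: "lin (\<lambda>x. x)"
  by (rule linI) auto

lemma lin_compose:
  assumes "lin f" "lin g"
  shows "lin (\<lambda>x. f (g x))"
  by (rule linI) (simp_all add: linD[OF assms(1)] linD[OF assms(2)])

lemma lin_add:
  assumes "lin f" "lin g"
  shows "lin (\<lambda>x. f x + g x)"
  by (rule linI) (simp_all add: linD[OF assms(1)] linD[OF assms(2)] vs.scale_right_distrib)

lemma lin_diff:
  assumes "lin f" "lin g"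
  shows "lin (\<lambda>x. f x - g x)"
  by (rule linI) (simp_all add: linD[OF assms(1)] linD[OF assms(2)] vs.scale_right_diff_distrib)

text \<open>Covers the inner argument of a nested \<open>lin_ext\<close>, the outer one being linear
  by construction; this gives right linearity of \<open>tensor\<close>, \<open>conc\<close> and
  \<open>tensor_mult\<close>.\<close>

lemma lin_lin_ext_param:
  assumes "\<And>b. lin (f b)"
  shows "lin (\<lambda>y. lin_ext (\<lambda>b. f b y) x)"
  by (rule linI)
    (simp_all add: lin_ext_def linD[OF assms] vs.scale_right_distrib sum.distrib vs.scale_sum_right
      mult.commute)

lemma lin_ext_diff: "lin_ext (\<lambda>b. f b - g b) x = lin_ext f x - lin_ext g x"
  by (simp add: lin_ext_def vs.scale_right_diff_distrib sum_subtractf)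

section \<open>Tensors, concatenation and their products on basis vectors\<close>

lemma tensor_eq_lin_ext:
  fixes x :: "'b \<Rightarrow>\<^sub>0 'k::field" and y :: "'c \<Rightarrow>\<^sub>0 'k"
  shows "tensor x y = lin_ext (\<lambda>b. lin_ext (\<lambda>c. basis_vec (b, c)) y) x"
proof -
  have "Poly_Mapping.single (b, c) (s * t) = vscale s (vscale t (basis_vec (b, c)))"
    for b :: 'b and c :: 'c and s t :: 'k
    by (rule poly_mapping_eqI) (simp add: lookup_basis_vec lookup_single when_def)
  then show ?thesis
    by (simp add: tensor_def lin_ext_def vs.scale_sum_right)
qed

lemma lin_tensor_left: "lin (\<lambda>x. tensor x y)"
  unfolding tensor_eq_lin_ext by (rule lin_lin_ext)

lemma lin_tensor_right: "lin (\<lambda>y. tensor x y)"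
  unfolding tensor_eq_lin_ext by (intro lin_lin_ext_param lin_lin_ext)

lemma tensor_basis_vec [simp]: "tensor (basis_vec a) (basis_vec b) = basis_vec (a, b)"
  by (simp add: tensor_eq_lin_ext)

lemma lin_tensor_map: "lin (tensor_map f g)"
  unfolding tensor_map_def by (rule lin_lin_ext)

lemma tensor_map_basis_vec [simp]:
  "tensor_map f g (basis_vec (b, c)) = tensor (f (basis_vec b)) (g (basis_vec c))"
  by (simp add: tensor_map_def)

lemma tensor_map_diff_left:
  "tensor_map (\<lambda>x. f x - f' x) g t = tensor_map f g t - tensor_map f' g t"
  by (simp add: tensor_map_def case_prod_unfold linD[OF lin_tensor_left] lin_ext_diff)

lemma tensor_map_diff_right:
  "tensor_map g (\<lambda>x. f x - f' x) t = tensor_map g f t - tensor_map g f' t"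
  by (simp add: tensor_map_def case_prod_unfold linD[OF lin_tensor_right] lin_ext_diff)

lemma lin_tensor_assoc: "lin tensor_assoc"
  unfolding tensor_assoc_def by (rule lin_lin_ext)

lemma tensor_assoc_basis_vec [simp]: "tensor_assoc (basis_vec ((a, b), c)) = basis_vec (a, b, c)"
  by (simp add: tensor_assoc_def)

lemma lin_conc_left: "lin (\<lambda>x. conc x y)"
  unfolding conc_def by (rule lin_lin_ext)

lemma lin_conc_right: "lin (\<lambda>y. conc x y)"
  unfolding conc_def by (intro lin_lin_ext_param lin_lin_ext)

lemma conc_basis_vec [simp]: "conc (basis_vec v) (basis_vec w) = basis_vec (v @ w)"
  by (simp add: conc_def)

lemma conc_assoc: "conc (conc x y) z = conc x (conc y z)"
proof (rule lin_eqI[of "\<lambda>x. conc (conc x y) z"])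
  fix u
  show "conc (conc (basis_vec u) y) z = conc (basis_vec u) (conc y z)"
  proof (rule lin_eqI[of "\<lambda>y. conc (conc (basis_vec u) y) z"])
    fix v
    show "conc (conc (basis_vec u) (basis_vec v)) z = conc (basis_vec u) (conc (basis_vec v) z)"
      by (rule lin_eqI[of "\<lambda>z. conc (conc (basis_vec u) (basis_vec v)) z"])
        (auto intro: lin_conc_right lin_compose)
  qed (auto intro: lin_conc_right lin_conc_left lin_compose[OF lin_conc_left lin_conc_right]
    lin_compose[OF lin_conc_right lin_conc_left])
qed (auto intro: lin_conc_left lin_compose[OF lin_conc_left lin_conc_left])

lemma conc_unit_left: "conc unit_T x = x"
  by (rule lin_eqI[OF lin_conc_right lin_id]) (simp add: unit_T_def)

lemma conc_unit_right: "conc x unit_T = x"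
  by (rule lin_eqI[OF lin_conc_left lin_id]) (simp add: unit_T_def)

abbreviation tmul :: "'k::field ncT2 \<Rightarrow> 'k ncT2 \<Rightarrow> 'k ncT2" (infixl "\<odot>" 70) where
  "s \<odot> t \<equiv> tensor_mult conc s t"

lemma lin_tmul_left: "lin (\<lambda>s. s \<odot> t)"
  unfolding tensor_mult_def by (rule lin_lin_ext)

lemma lin_tmul_right: "lin (\<lambda>t. s \<odot> t)"
  unfolding tensor_mult_def case_prod_unfold by (intro lin_lin_ext_param lin_lin_ext)

lemma tmul_basis_vec [simp]: "basis_vec (a, b) \<odot> basis_vec (c, d) = basis_vec (a @ c, b @ d)"
  by (simp add: tensor_mult_def)

lemma tmul_assoc: "(s \<odot> t) \<odot> u = s \<odot> (t \<odot> u)"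
proof (rule lin_eqI[of "\<lambda>s. (s \<odot> t) \<odot> u"])
  fix p :: "ncp list \<times> ncp list"
  show "(basis_vec p \<odot> t) \<odot> u = basis_vec p \<odot> (t \<odot> u)"
  proof (rule lin_eqI[of "\<lambda>t. (basis_vec p \<odot> t) \<odot> u"])
    fix q :: "ncp list \<times> ncp list"
    show "(basis_vec p \<odot> basis_vec q) \<odot> u = basis_vec p \<odot> (basis_vec q \<odot> u)"
    proof (rule lin_eqI[of "\<lambda>u. (basis_vec p \<odot> basis_vec q) \<odot> u"])
      fix r :: "ncp list \<times> ncp list"
      show "(basis_vec p \<odot> basis_vec q) \<odot> basis_vec r = basis_vec p \<odot> (basis_vec q \<odot> basis_vec r)"
        by (cases p; cases q; cases r) simp
    qed (auto intro: lin_tmul_right lin_compose[OF lin_tmul_right lin_tmul_right])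
  qed (auto intro: lin_compose[OF lin_tmul_left lin_tmul_right]
    lin_compose[OF lin_tmul_right lin_tmul_left])
qed (auto intro: lin_tmul_left lin_compose[OF lin_tmul_left lin_tmul_left])

lemma tmul_unit_left: "basis_vec ([], []) \<odot> t = t"
  by (rule lin_eqI[OF lin_tmul_right lin_id]) auto

lemma tmul_unit_right: "t \<odot> basis_vec ([], []) = t"
  by (rule lin_eqI[OF lin_tmul_left lin_id]) auto

lemma tmul_sum_basis_vec:
  "(\<Sum>i\<in>I. basis_vec (f i, g i)) \<odot> (\<Sum>j\<in>J. basis_vec (f' j, g' j))
    = (\<Sum>(i, j)\<in>I \<times> J. basis_vec (f i @ f' j, g i @ g' j))"
  unfolding linD(5)[OF lin_tmul_left] unfolding linD(5)[OF lin_tmul_right]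
  by (simp add: sum.cartesian_product)

lemma coprod_word_append: "coprod_word (v @ w) = coprod_word v \<odot> coprod_word w"
  by (induction v) (simp_all add: unit_T_def tmul_unit_left tmul_assoc)

section \<open>The coproducts of a separated family\<close>

text \<open>
  The predicate \<open>c\<close> is applied to the truth value of ``the block of 1 belongs to \<open>Q\<close>'': the
  constant predicate gives \<open>\<Delta>\<close>, the identity \<open>\<Delta>\<^sup>+\<close> with \<open>\<prec>\<close> and negation \<open>\<Delta>\<^sup>+\<close> with \<open>\<succ>\<close>.
\<close>

definition half_word :: "(bool \<Rightarrow> bool) \<Rightarrow> ncp list \<Rightarrow> 'k::field ncT2" where
  "half_word c w = (case w of [] \<Rightarrow> basis_vec ([], [])
     | L # v \<Rightarrow> coprod_sum (\<lambda>Q. c (1 \<in> \<Union>Q)) L \<odot> coprod_word v)"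

text \<open>The condition \<open>c\<close> is imposed on the first letter alone, and a nonempty
  \<open>v\<close> contains it; the letters of \<open>w\<close> contribute the full
  coproduct.\<close>

lemma half_word_append: "v \<noteq> [] \<Longrightarrow> half_word c (v @ w) = half_word c v \<odot> coprod_word w"
  by (cases v) (simp_all add: half_word_def coprod_word_append tmul_assoc)

lemma half_word_single: "half_word c [L] = coprod_sum (\<lambda>Q. c (1 \<in> \<Union>Q)) L"
  by (simp add: half_word_def unit_T_def tmul_unit_right)

lemma half_word_True: "half_word (\<lambda>_. True) w = coprod_word w"
  by (cases w) (simp_all add: half_word_def unit_T_def coprod_gen_def)

text \<open>On the empty word \<open>prec_word\<close> is zero and \<open>half_word\<close> is the
  unit tensor, so the relation between reduced and unreduced maps persists there.\<close>

lemma half_word_prec: "half_word (\<lambda>b. b) w = prec_word w + basis_vec (w, [])"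
proof (cases w)
  case (Cons L v)
  have "(\<lambda>Q. 1 \<in> \<Union>Q) = (\<lambda>Q. \<exists>B\<in>Q. (1::nat) \<in> B)"
    by auto
  then show ?thesis
    by (simp add: Cons half_word_def prec_plus_gen_def unit_T_def)
qed (simp add: half_word_def)

text \<open>The blocks of \<open>L\<close> are disjoint and one of them contains 1, so 1 avoids
  \<open>\<Union>Q\<close> exactly when its block belongs to the complement of
  \<open>Q\<close>.\<close>

lemma half_word_succ: "half_word Not w = succ_word w + basis_vec ([], w)"
proof (cases w)
  case (Cons L v)
  obtain n where n: "n \<ge> 1" "blocks L \<in> NC n"
    using blocks[of L] by auto
  have "1 \<notin> \<Union>Q \<longleftrightarrow> (\<exists>B\<in>blocks L - Q. 1 \<in> B)" if "Q \<in> admissible (blocks L)" for Q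
  proof -
    have "1 \<in> \<Union>(blocks L)"
      using n by (auto simp: NC_def partition_on_def)
    moreover have "Q \<subseteq> blocks L"
      using that by (auto simp: admissible_def)
    ultimately show ?thesis
      using separatedD(5)[OF NC_separated[OF n(2)]] by blast
  qed
  then have "{Q \<in> admissible (blocks L). 1 \<notin> \<Union>Q} = {Q \<in> admissible (blocks L). \<exists>B\<in>blocks L - Q. 1 \<in> B}"
    by blast
  then have "coprod_sum (\<lambda>Q. 1 \<notin> \<Union>Q) L = (succ_plus_gen L :: 'a ncT2)"
    unfolding coprod_sum_def succ_plus_gen_def by simp
  then show ?thesis
    by (simp add: Cons half_word_def unit_T_def)
qed (simp add: half_word_def)

text \<open>The least point of \<open>\<Union>V\<close> takes over the role of 1. For empty
  \<open>V\<close> it has no meaning, and the expansions below then admit only the constant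
  predicate.\<close>

definition half_admissible :: "(bool \<Rightarrow> bool) \<Rightarrow> nat set set \<Rightarrow> nat set set set" where
  "half_admissible c V = {R \<in> admissible V. c (Min (\<Union>V) \<in> \<Union>R)}"

lemma finite_admissible: "finite V \<Longrightarrow> finite (admissible V)"
  by (rule finite_subset[of _ "Pow V"]) (auto simp: admissible_def)

lemma finite_half_admissible: "finite V \<Longrightarrow> finite (half_admissible c V)"
  by (simp add: half_admissible_def finite_admissible)

text \<open>The one-letter case, transported along the rank map \<open>st (\<Union>V)\<close>: it
  matches admissible subfamilies, sends the least point to 1 and leaves words unchanged.\<close>

lemma half_word_standardize:
  assumes "separated A V" "V \<noteq> {}"
  shows "(half_word c [Abs_ncp (standardize V)] :: 'k::field ncT2)
    = (\<Sum>R\<in>half_admissible c V. basis_vec (sep_word {} R, sep_word (\<Union>R) (V - R)))"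
proof -
  let ?f = "st (\<Union>V)" and ?L = "standardize V"
  note D = separatedD[OF assms(1)]
  have s: "separated {} V"
    using separated_mono[OF assms(1)] by blast
  have mono: "strict_mono_on (\<Union>V) ?f"
    using D(2) by (rule st_strict_mono_on)
  have L: "?L = (`) ?f ` V"
    by (simp add: standardize_def)
  note NC = blocks_Abs_ncp_standardize[OF assms]
  have adm: "admissible ?L = (`) ((`) ?f) ` admissible V" and injV: "inj_on ((`) ?f) V"
    unfolding L using admissible_image[OF assms(1) mono] by auto
  have one: "1 \<in> \<Union>((`) ?f ` R) \<longleftrightarrow> Min (\<Union>V) \<in> \<Union>R" if "R \<subseteq> V" for R
  proof -
    have "1 = ?f x \<longleftrightarrow> x = Min (\<Union>V)" if "x \<in> \<Union>R" for x
      using st_eq_1_iff[OF D(2), of x] that \<open>R \<subseteq> V\<close> by (metis UnionE UnionI subsetD)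
    then show ?thesis
      by (auto simp: image_iff)
  qed
  have sub: "R \<subseteq> V" if "R \<in> half_admissible c V" for R
    using that by (auto simp: half_admissible_def admissible_def)
  have set_eq: "{Q \<in> admissible ?L. c (1 \<in> \<Union>Q)} = (`) ((`) ?f) ` half_admissible c V"
  proof -
    have "c (1 \<in> \<Union>((`) ?f ` R)) \<longleftrightarrow> c (Min (\<Union>V) \<in> \<Union>R)" if "R \<in> admissible V" for R
      using one[of R] that by (simp add: admissible_def)
    then show ?thesis
      unfolding adm half_admissible_def by auto
  qed
  have inj2: "inj_on ((`) ((`) ?f)) (half_admissible c V)"
    using inj_on_image_eq_iff[OF injV] sub by (intro inj_onI) blast
  have "(half_word c [Abs_ncp ?L] :: 'k ncT2) = (\<Sum>Q\<in>{Q \<in> admissible ?L. c (1 \<in> \<Union>Q)}. basis_vec (st_word Q, pieces ?L Q))"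
    by (simp add: half_word_single coprod_sum_def NC(1))
  also have "\<dots> = (\<Sum>R\<in>half_admissible c V. basis_vec (st_word ((`) ?f ` R), pieces ?L ((`) ?f ` R)))"
    unfolding set_eq by (simp add: sum.reindex[OF inj2])
  also have "\<dots> = (\<Sum>R\<in>half_admissible c V. basis_vec (sep_word {} R, sep_word (\<Union>R) (V - R)))"
  proof (rule sum.cong[OF refl])
    fix R assume R: "R \<in> half_admissible c V"
    note RV = sub[OF R]
    have sR: "separated {} R"
      using separated_mono[OF s RV] by blast
    have sL: "separated {} ((`) ?f ` R)"
      using separated_mono[OF NC_separated[OF NC(2)], of "(`) ?f ` R"] RV unfolding L by blast
    have "st_word ((`) ?f ` R) = sep_word {} R"
      using st_word_eq_sep_word[OF sL] sep_word_image[OF sR mono] RV by auto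
    moreover have "pieces ?L ((`) ?f ` R) = sep_word (\<Union>R) (V - R)"
    proof -
      have "pieces ?L ((`) ?f ` R) = sep_word (\<Union>((`) ?f ` R)) (?L - (`) ?f ` R)"
        using RV unfolding L by (intro pieces_eq_sep_word[OF NC(2)[unfolded L]]) blast
      also have "\<Union>((`) ?f ` R) = ?f ` \<Union>R"
        by blast
      also have "?L - (`) ?f ` R = (`) ?f ` (V - R)"
        unfolding L using inj_on_image_set_diff[OF injV, of V R] RV by simp
      also have "sep_word (?f ` \<Union>R) ((`) ?f ` (V - R)) = sep_word (\<Union>R) (V - R)"
      proof (rule sep_word_image[OF _ mono])
        show "separated (\<Union>R) (V - R)"
          using separated_admissible[OF s, of R] R by (simp add: half_admissible_def)
      qed (use RV in blast)+
      finally show ?thesis .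
    qed
    ultimately show "basis_vec (st_word ((`) ?f ` R), pieces ?L ((`) ?f ` R))
        = (basis_vec (sep_word {} R, sep_word (\<Union>R) (V - R)) :: 'k ncT2)"
      by simp
  qed
  finally show ?thesis .
qed

section \<open>From single letters to words\<close>

text \<open>A block nested in another has points on both sides of it in that other block, which is
  impossible across the cut at \<open>a\<close>; hence admissibility decouples into the two
  sides.\<close>

lemma admissible_Un:
  assumes "separated A (V1 \<union> V2)" "\<And>x. x \<in> \<Union>V1 \<Longrightarrow> x < a" "\<And>x. x \<in> \<Union>V2 \<Longrightarrow> a < x"
  shows "R \<in> admissible (V1 \<union> V2)
    \<longleftrightarrow> R \<subseteq> V1 \<union> V2 \<and> R \<inter> V1 \<in> admissible V1 \<and> R \<inter> V2 \<in> admissible V2"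
proof -
  note D = separatedD[OF assms(1)]
  have cross: "\<not> nested B C" if BC: "B \<in> V1 \<and> C \<in> V2 \<or> B \<in> V2 \<and> C \<in> V1" for B C
  proof
    assume n: "nested B C"
    obtain m where m: "m \<in> B"
      using D(4)[of B] BC by blast
    have C: "finite C" "C \<noteq> {}"
      using D(3,4)[of C] that by auto
    then obtain c d where "c \<in> C" "c < m" "d \<in> C" "m < d"
      using n m unfolding nested_iff[OF C] by blast
    then show False
      using assms(2)[of m] assms(2)[of c] assms(2)[of d] assms(3)[of m] assms(3)[of c] assms(3)[of d] BC m
      by (metis UnionI less_asym less_trans)
  qed
  show ?thesis
  proof (cases "R \<subseteq> V1 \<union> V2")
    case True
    have eq: "(\<exists>B\<in>R. \<exists>C\<in>V1 \<union> V2 - R. nested B C) \<longleftrightarrow>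
        (\<exists>B\<in>R \<inter> V1. \<exists>C\<in>V1 - R \<inter> V1. nested B C) \<or> (\<exists>B\<in>R \<inter> V2. \<exists>C\<in>V2 - R \<inter> V2. nested B C)"
    proof
      assume "\<exists>B\<in>R. \<exists>C\<in>V1 \<union> V2 - R. nested B C"
      then obtain B C where "B \<in> R" "C \<in> V1 \<union> V2" "C \<notin> R" "nested B C"
        by blast
      then show "(\<exists>B\<in>R \<inter> V1. \<exists>C\<in>V1 - R \<inter> V1. nested B C) \<or> (\<exists>B\<in>R \<inter> V2. \<exists>C\<in>V2 - R \<inter> V2. nested B C)"
        using True cross[of B C] by blast
    qed blast
    show ?thesis
      unfolding admissible_def mem_Collect_eq eq
      by (simp only: Int_lower2 de_Morgan_disj simp_thms conj_assoc)
  qed (auto simp: admissible_def)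
qed

text \<open>At a cut the product of the two expansions is reindexed by \<open>R \<inter> V1\<close>
  and \<open>R \<inter> V2\<close>. The least point lies in \<open>V1\<close>, so \<open>c\<close>
  restricts only the first factor; the second is expanded with the constant predicate, which is why
  \<open>c\<close> varies in the induction.\<close>

lemma half_word_sep_word:
  assumes "separated A V" "V \<noteq> {}"
  shows "(half_word c (sep_word A V) :: 'k::field ncT2)
    = (\<Sum>R\<in>half_admissible c V. basis_vec (sep_word A R, sep_word (A \<union> \<Union>R) (V - R)))"
  using assms
proof (induction arbitrary: c rule: separated_induct)
  case empty
  then show ?case by simp
next
  case (single V)
  note D = separatedD[OF single(1)]
  have "sep_word A V = [Abs_ncp (standardize V)]"
    using D single by (intro sep_word_single) auto
  moreover have "sep_word A R = sep_word {} R \<and> sep_word (A \<union> \<Union>R) (V - R) = sep_word (\<Union>R) (V - R)"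
    if "R \<in> half_admissible c V" for R
  proof -
    have RV: "R \<subseteq> V"
      using that by (auto simp: half_admissible_def admissible_def)
    have "a \<notin> A" if "x \<in> \<Union>V" "y \<in> \<Union>V" "x < a" "a < y" for a x y
      using single(3) that unfolding splits_def by blast
    then show ?thesis
      using RV by (intro conjI sep_word_cong) blast+
  qed
  ultimately show ?case
    by (simp add: half_word_standardize[OF single(1,2)])
next
  case (Un a V1 V2)
  let ?t = "\<lambda>V R. (sep_word A R, sep_word (A \<union> \<Union>R) (V - R))"
  note D = separatedD[OF Un(1)]
  have dis: "V1 \<inter> V2 = {}"
  proof -
    have "B \<notin> V2" if BV: "B \<in> V1" for B
    proof
      assume "B \<in> V2"
      moreover obtain x where "x \<in> B"
        using D(4)[of B] BV by blast
      ultimately show False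
        using Un(5)[of x] Un(6)[of x] that by fastforce
    qed
    then show ?thesis by blast
  qed
  have s: "separated A V1" "separated A V2"
    using separated_mono[OF Un(1)] by blast+
  have ne: "sep_word A V1 \<noteq> []"
    using sep_word_eq_Nil_iff[OF s(1)] Un(3) by simp
  have m: "Min (\<Union>(V1 \<union> V2)) = Min (\<Union>V1)"
  proof -
    have "\<Union>V1 \<noteq> {}" "\<Union>V2 \<noteq> {}"
      using Un(3,4) D(4) by blast+
    moreover have "finite (\<Union>V1)" "finite (\<Union>V2)"
      using D(2) by simp_all
    ultimately have "Min (\<Union>V1 \<union> \<Union>V2) = min (Min (\<Union>V1)) (Min (\<Union>V2))"
      and "Min (\<Union>V1) < a" "a < Min (\<Union>V2)"
      by (simp_all only: Min_Un Un(5) Un(6) Min_in not_False_eq_True)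
    then show ?thesis
      by simp
  qed
  have mV1: "Min (\<Union>V1) < a"
  proof -
    have "\<Union>V1 \<noteq> {}" "finite (\<Union>V1)"
      using Un(3) D(2,4) by auto
    then show ?thesis
      using Un(5) Min_in by blast
  qed
  have "(half_word c (sep_word A (V1 \<union> V2)) :: 'k ncT2) = half_word c (sep_word A V1) \<odot> half_word (\<lambda>_. True) (sep_word A V2)"
    using sep_word_Un_separated[OF Un(1,2,5,6)] half_word_append[OF ne] half_word_True by metis
  also have "\<dots> = (\<Sum>R\<in>half_admissible c V1. basis_vec (?t V1 R)) \<odot>
      (\<Sum>R\<in>half_admissible (\<lambda>_. True) V2. basis_vec (?t V2 R))"
    using Un(7,8) Un(3,4) by simp
  also have "\<dots> = (\<Sum>(R, R')\<in>half_admissible c V1 \<times> half_admissible (\<lambda>_. True) V2.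
      basis_vec (sep_word A R @ sep_word A R', sep_word (A \<union> \<Union>R) (V1 - R) @ sep_word (A \<union> \<Union>R') (V2 - R')))"
    by (rule tmul_sum_basis_vec)
  also have "\<dots> = (\<Sum>R\<in>half_admissible c (V1 \<union> V2). basis_vec (?t (V1 \<union> V2) R))"
  proof (rule sum.reindex_bij_witness[of _ "\<lambda>R. (R \<inter> V1, R \<inter> V2)" "\<lambda>(R, R'). R \<union> R'"])
    fix p assume p: "p \<in> half_admissible c V1 \<times> half_admissible (\<lambda>_. True) V2"
    obtain R1 R2 where p': "p = (R1, R2)"
      by (cases p)
    have R: "R1 \<in> admissible V1" "R2 \<in> admissible V2" "c (Min (\<Union>V1) \<in> \<Union>R1)"
      using p p' by (auto simp: half_admissible_def)
    have sub: "R1 \<subseteq> V1" "R2 \<subseteq> V2"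
      using R by (auto simp: admissible_def)
    then have int: "(R1 \<union> R2) \<inter> V1 = R1" "(R1 \<union> R2) \<inter> V2 = R2"
      using dis by blast+
    show "((case p of (R, R') \<Rightarrow> R \<union> R') \<inter> V1, (case p of (R, R') \<Rightarrow> R \<union> R') \<inter> V2) = p"
      using p' int by simp
    have adm: "R1 \<union> R2 \<in> admissible (V1 \<union> V2)"
      using admissible_Un[OF Un(1,5,6)] R sub int by auto
    have "Min (\<Union>V1) \<notin> \<Union>R2"
      using mV1 Un(6)[of "Min (\<Union>V1)"] sub by fastforce
    then have mR: "Min (\<Union>V1) \<in> \<Union>(R1 \<union> R2) \<longleftrightarrow> Min (\<Union>V1) \<in> \<Union>R1"
      by blast
    show "(case p of (R, R') \<Rightarrow> R \<union> R') \<in> half_admissible c (V1 \<union> V2)"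
      unfolding p' half_admissible_def prod.case mem_Collect_eq m mR using adm R(3) by (rule conjI)
    have "sep_word A (R1 \<union> R2) = sep_word A R1 @ sep_word A R2"
    proof (rule sep_word_Un_separated[OF _ Un(2)])
      show "separated A (R1 \<union> R2)"
        by (rule separated_mono[OF Un(1)]) (use sub in auto)
    qed (use sub Un(5,6) in blast)+
    moreover have "sep_word (A \<union> \<Union>(R1 \<union> R2)) (V1 \<union> V2 - (R1 \<union> R2))
        = sep_word (A \<union> \<Union>R1) (V1 - R1) @ sep_word (A \<union> \<Union>R2) (V2 - R2)"
    proof -
      have "V1 \<union> V2 - (R1 \<union> R2) = (V1 - R1) \<union> (V2 - R2)"
        using sub dis by blast
      moreover have "sep_word (A \<union> \<Union>(R1 \<union> R2)) ((V1 - R1) \<union> (V2 - R2))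
        = sep_word (A \<union> \<Union>(R1 \<union> R2)) (V1 - R1) @ sep_word (A \<union> \<Union>(R1 \<union> R2)) (V2 - R2)"
      proof (rule sep_word_Un_separated)
        show "separated (A \<union> \<Union>(R1 \<union> R2)) ((V1 - R1) \<union> (V2 - R2))"
          using separated_admissible[OF Un(1) adm] \<open>V1 \<union> V2 - (R1 \<union> R2) = (V1 - R1) \<union> (V2 - R2)\<close> by simp
        show "a \<in> A \<union> \<Union>(R1 \<union> R2)"
          using Un(2) by simp
      qed (use Un(5,6) in blast)+
      \<comment> \<open>Points of \<open>R2\<close> lie beyond \<open>a\<close> and never between
        two points of \<open>V1\<close>, so they cut nothing there.\<close>
      moreover have "sep_word (A \<union> \<Union>(R1 \<union> R2)) (V1 - R1) = sep_word (A \<union> \<Union>R1) (V1 - R1)"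
      proof (rule sep_word_cong)
        fix b x y assume "x \<in> \<Union>(V1 - R1)" "y \<in> \<Union>(V1 - R1)" "x < b" "b < y"
        then have "b < a"
          using Un(5)[of y] by fastforce
        then have "b \<notin> \<Union>R2"
          using Un(6)[of b] sub by fastforce
        then show "b \<in> A \<union> \<Union>(R1 \<union> R2) \<longleftrightarrow> b \<in> A \<union> \<Union>R1"
          by blast
      qed
      moreover have "sep_word (A \<union> \<Union>(R1 \<union> R2)) (V2 - R2) = sep_word (A \<union> \<Union>R2) (V2 - R2)"
      proof (rule sep_word_cong)
        fix b x y assume "x \<in> \<Union>(V2 - R2)" "y \<in> \<Union>(V2 - R2)" "x < b" "b < y"
        then have "a < b"
          using Un(6)[of x] by fastforce
        then have "b \<notin> \<Union>R1"
          using Un(5)[of b] sub by fastforce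
        then show "b \<in> A \<union> \<Union>(R1 \<union> R2) \<longleftrightarrow> b \<in> A \<union> \<Union>R2"
          by blast
      qed
      ultimately show ?thesis
        by simp
    qed
    ultimately show "(basis_vec (?t (V1 \<union> V2) (case p of (R, R') \<Rightarrow> R \<union> R')) :: 'k ncT2) = (case p of (R, R') \<Rightarrow>
      basis_vec (sep_word A R @ sep_word A R', sep_word (A \<union> \<Union>R) (V1 - R) @ sep_word (A \<union> \<Union>R') (V2 - R')))"
      using p' by simp
  next
    fix R assume "R \<in> half_admissible c (V1 \<union> V2)"
    then have R: "R \<in> admissible (V1 \<union> V2)" "c (Min (\<Union>V1) \<in> \<Union>R)"
      unfolding half_admissible_def mem_Collect_eq m by blast+
    then have sub: "R \<subseteq> V1 \<union> V2" and adm: "R \<inter> V1 \<in> admissible V1" "R \<inter> V2 \<in> admissible V2"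
      using admissible_Un[OF Un(1,5,6)] by blast+
    show "(case (R \<inter> V1, R \<inter> V2) of (R, R') \<Rightarrow> R \<union> R') = R"
      using sub by auto
    have "Min (\<Union>V1) \<notin> \<Union>V2"
      using mV1 Un(6)[of "Min (\<Union>V1)"] by fastforce
    then have "Min (\<Union>V1) \<in> \<Union>R \<longleftrightarrow> Min (\<Union>V1) \<in> \<Union>(R \<inter> V1)"
      using sub by blast
    then show "(R \<inter> V1, R \<inter> V2) \<in> half_admissible c V1 \<times> half_admissible (\<lambda>_. True) V2"
      using adm R(2) by (simp add: half_admissible_def)
  qed
  finally show ?case .
qed

lemma coprod_word_sep_word:
  assumes "separated A V"
  shows "(coprod_word (sep_word A V) :: 'k::field ncT2)
    = (\<Sum>R\<in>half_admissible (\<lambda>_. True) V. basis_vec (sep_word A R, sep_word (A \<union> \<Union>R) (V - R)))"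
proof (cases "V = {}")
  case True
  have "half_admissible (\<lambda>_. True) {} = {{}}"
    by (auto simp: half_admissible_def admissible_def)
  then show ?thesis
    by (simp add: True unit_T_def)
next
  case False
  then show ?thesis
    using half_word_sep_word[OF assms False, of "\<lambda>_. True"] by (simp add: half_word_True)
qed

definition half_coprod :: "(bool \<Rightarrow> bool) \<Rightarrow> 'k::field ncT \<Rightarrow> 'k ncT2" where
  "half_coprod c = lin_ext (half_word c)"

lemma lin_half_coprod: "lin (half_coprod c)"
  unfolding half_coprod_def by (rule lin_lin_ext)

lemma half_coprod_True: "half_coprod (\<lambda>_. True) = coprod"
  by (simp add: half_coprod_def coprod_def half_word_True[abs_def])

lemma lin_coprod: "lin coprod"
  unfolding coprod_def by (rule lin_lin_ext)

lemma coprod_basis_vec [simp]: "coprod (basis_vec w) = coprod_word w"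
  by (simp add: coprod_def)

lemma half_coprod_sep_word:
  assumes "separated A V" "V \<noteq> {} \<or> c = (\<lambda>_. True)"
  shows "half_coprod c (basis_vec (sep_word A V) :: 'k::field ncT)
    = (\<Sum>R\<in>half_admissible c V. basis_vec (sep_word A R, sep_word (A \<union> \<Union>R) (V - R)))"
  using assms(2)
proof
  assume "V \<noteq> {}"
  then show ?thesis
    using half_word_sep_word[OF assms(1)] by (simp add: half_coprod_def)
next
  assume "c = (\<lambda>_. True)"
  then show ?thesis
    using coprod_word_sep_word[OF assms(1)] by (simp add: half_coprod_True)
qed

lemma lin_unit_right: "lin (\<lambda>x. tensor x unit_T)"
  by (rule lin_tensor_left)

lemma lin_unit_left: "lin (\<lambda>x. tensor unit_T x)"
  by (rule lin_tensor_right)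

lemma coprod_prec_eq: "coprod_prec = (\<lambda>x. half_coprod (\<lambda>b. b) x - tensor x unit_T)"
proof
  fix x :: "'a ncT"
  show "coprod_prec x = half_coprod (\<lambda>b. b) x - tensor x unit_T"
    unfolding coprod_prec_def half_coprod_def
    by (rule lin_eqI[OF lin_lin_ext lin_diff[OF lin_lin_ext lin_unit_right]])
      (simp add: half_word_prec unit_T_def)
qed

lemma coprod_succ_eq: "coprod_succ = (\<lambda>x. half_coprod Not x - tensor unit_T x)"
proof
  fix x :: "'a ncT"
  show "coprod_succ x = half_coprod Not x - tensor unit_T x"
    unfolding coprod_succ_def half_coprod_def
    by (rule lin_eqI[OF lin_lin_ext lin_diff[OF lin_lin_ext lin_unit_left]])
      (simp add: half_word_succ unit_T_def)
qed

lemma lin_coprod_prec: "lin coprod_prec"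
  unfolding coprod_prec_def by (rule lin_lin_ext)

lemma lin_coprod_succ: "lin coprod_succ"
  unfolding coprod_succ_def by (rule lin_lin_ext)

section \<open>Coassociativity\<close>

text \<open>The second coproduct refines the left factor \<open>Q\<close> with the same separators
  \<open>A\<close>. The hypothesis on \<open>Q\<close> keeps restricted half-coproducts away from
  the unit.\<close>

lemma left_half_coprod_sep_word:
  assumes "separated A V" "V \<noteq> {} \<or> c2 = (\<lambda>_. True)"
    "\<forall>Q\<in>half_admissible c2 V. Q \<noteq> {} \<or> c1 = (\<lambda>_. True)"
  shows "tensor_assoc (tensor_map (half_coprod c1) id (half_coprod c2 (basis_vec (sep_word A V) :: 'k::field ncT)))
    = (\<Sum>(Q, P)\<in>Sigma (half_admissible c2 V) (half_admissible c1).
        basis_vec (sep_word A P, sep_word (A \<union> \<Union>P) (Q - P), sep_word (A \<union> \<Union>Q) (V - Q)))"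
proof -
  note D = separatedD[OF assms(1)]
  have "tensor_assoc (tensor (half_coprod c1 (basis_vec (sep_word A Q) :: 'k ncT)) (basis_vec (sep_word (A \<union> \<Union>Q) (V - Q))))
      = (\<Sum>P\<in>half_admissible c1 Q.
        basis_vec (sep_word A P, sep_word (A \<union> \<Union>P) (Q - P), sep_word (A \<union> \<Union>Q) (V - Q)))"
    if Q: "Q \<in> half_admissible c2 V" for Q
  proof -
    have "Q \<subseteq> V"
      using Q by (auto simp: half_admissible_def admissible_def)
    then have "separated A Q"
      using separated_mono[OF assms(1)] by blast
    then show ?thesis
      by (simp add: half_coprod_sep_word[OF _ bspec[OF assms(3) Q]] linD(5)[OF lin_tensor_left]
        linD(5)[OF lin_tensor_assoc])
  qed
  moreover have "\<forall>Q\<in>half_admissible c2 V. finite (half_admissible c1 Q)"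
    using D(1) finite_subset by (intro ballI finite_half_admissible)
      (auto simp: half_admissible_def admissible_def)
  ultimately show ?thesis
    using finite_half_admissible[OF D(1)]
    by (simp add: half_coprod_sep_word[OF assms(1,2)] linD(5)[OF lin_tensor_map]
      linD(5)[OF lin_tensor_assoc] sum.Sigma)
qed

text \<open>The right factor is the word of the separated pair
  \<open>(A \<union> \<Union>P, V - P)\<close>, so the expansion applies to it again.\<close>

lemma right_half_coprod_sep_word:
  assumes "separated A V" "V \<noteq> {} \<or> c2 = (\<lambda>_. True)"
    "\<forall>P\<in>half_admissible c2 V. V - P \<noteq> {} \<or> c1 = (\<lambda>_. True)"
  shows "tensor_map id (half_coprod c1) (half_coprod c2 (basis_vec (sep_word A V) :: 'k::field ncT))
    = (\<Sum>(P, R)\<in>Sigma (half_admissible c2 V) (\<lambda>P. half_admissible c1 (V - P)).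
        basis_vec (sep_word A P, sep_word (A \<union> \<Union>P) R, sep_word (A \<union> \<Union>P \<union> \<Union>R) (V - P - R)))"
proof -
  note D = separatedD[OF assms(1)]
  have "tensor (basis_vec (sep_word A P) :: 'k ncT) (half_coprod c1 (basis_vec (sep_word (A \<union> \<Union>P) (V - P))))
      = (\<Sum>R\<in>half_admissible c1 (V - P).
        basis_vec (sep_word A P, sep_word (A \<union> \<Union>P) R, sep_word (A \<union> \<Union>P \<union> \<Union>R) (V - P - R)))"
    if P: "P \<in> half_admissible c2 V" for P
  proof -
    have "separated (A \<union> \<Union>P) (V - P)"
      using separated_admissible[OF assms(1)] P by (simp add: half_admissible_def)
    then show ?thesis
      by (simp add: half_coprod_sep_word[OF _ bspec[OF assms(3) P]] linD(5)[OF lin_tensor_right])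
  qed
  moreover have "\<forall>P\<in>half_admissible c2 V. finite (half_admissible c1 (V - P))"
    using D(1) by (intro ballI finite_half_admissible) simp
  ultimately show ?thesis
    using finite_half_admissible[OF D(1)]
    by (simp add: half_coprod_sep_word[OF assms(1,2)] linD(5)[OF lin_tensor_map] sum.Sigma)
qed

text \<open>For the layers \<open>P\<close>, \<open>Q - P\<close>, \<open>V - Q\<close> both sides
  say that no block is nested in a block of a later layer; the three pairs of layers are merely
  distributed differently over the two admissibility conditions.\<close>

lemma admissible_chain_iff:
  assumes "P \<subseteq> Q"
  shows "Q \<in> admissible V \<and> P \<in> admissible Q \<longleftrightarrow> P \<in> admissible V \<and> Q - P \<in> admissible (V - P) \<and> Q \<subseteq> V"
proof (intro iffI conjI; elim conjE)
  assume Q: "Q \<in> admissible V" and P: "P \<in> admissible Q"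
  have QV: "Q \<subseteq> V" and nQ: "\<And>B C. B \<in> Q \<Longrightarrow> C \<in> V - Q \<Longrightarrow> \<not> nested B C"
    and nP: "\<And>B C. B \<in> P \<Longrightarrow> C \<in> Q - P \<Longrightarrow> \<not> nested B C"
    using Q P by (auto simp: admissible_def)
  show "Q \<subseteq> V"
    by (fact QV)
  have "\<not> nested B C" if "B \<in> P" "C \<in> V - P" for B C
    using nP[of B C] nQ[of B C] assms that by blast
  then show "P \<in> admissible V"
    using assms QV by (auto simp: admissible_def)
  show "Q - P \<in> admissible (V - P)"
    using nQ QV by (auto simp: admissible_def)
next
  assume P: "P \<in> admissible V" and R: "Q - P \<in> admissible (V - P)" and QV: "Q \<subseteq> V"
  have nP: "\<And>B C. B \<in> P \<Longrightarrow> C \<in> V - P \<Longrightarrow> \<not> nested B C"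
    and nR: "\<And>B C. B \<in> Q - P \<Longrightarrow> C \<in> V - P - (Q - P) \<Longrightarrow> \<not> nested B C"
    using P R unfolding admissible_def by blast+
  show "P \<in> admissible Q"
    using assms QV nP by (auto simp: admissible_def)
  have "\<not> nested B C" if "B \<in> Q" "C \<in> V - Q" for B C
    using nP[of B C] nR[of B C] assms that by blast
  then show "Q \<in> admissible V"
    using QV by (auto simp: admissible_def)
qed

text \<open>All coassociativity relations at once: the predicates matter only through the
  equivalence \<open>cond\<close>. The substitution of \<open>Q - P\<close> for \<open>Q\<close>
  preserves labels, since the removed points add up to \<open>\<Union>Q\<close> and the remaining
  blocks are \<open>V - Q\<close>.\<close>

lemma half_coassoc_sep_word:
  assumes "separated A V" "V \<noteq> {} \<or> c2 = (\<lambda>_. True)" "V \<noteq> {} \<or> d2 = (\<lambda>_. True)"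
    and "\<forall>Q\<in>half_admissible c2 V. Q \<noteq> {} \<or> c1 = (\<lambda>_. True)"
    and "\<forall>P\<in>half_admissible d2 V. V - P \<noteq> {} \<or> d1 = (\<lambda>_. True)"
    and cond: "\<And>P Q. P \<subseteq> Q \<Longrightarrow> Q \<subseteq> V \<Longrightarrow>
      c2 (Min (\<Union>V) \<in> \<Union>Q) \<and> c1 (Min (\<Union>Q) \<in> \<Union>P)
      \<longleftrightarrow> d2 (Min (\<Union>V) \<in> \<Union>P) \<and> d1 (Min (\<Union>(V - P)) \<in> \<Union>(Q - P))"
  shows "tensor_assoc (tensor_map (half_coprod c1) id (half_coprod c2 (basis_vec (sep_word A V) :: 'k::field ncT)))
    = tensor_map id (half_coprod d1) (half_coprod d2 (basis_vec (sep_word A V)))"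
  unfolding left_half_coprod_sep_word[OF assms(1,2,4)] right_half_coprod_sep_word[OF assms(1,3,5)]
proof (rule sum.reindex_bij_witness[of _ "\<lambda>(P, R). (P \<union> R, P)" "\<lambda>(Q, P). (P, Q - P)"])
  fix p assume p: "p \<in> Sigma (half_admissible c2 V) (half_admissible c1)"
  obtain Q P where p': "p = (Q, P)"
    by (cases p)
  have QP: "Q \<in> admissible V" "P \<in> admissible Q" "c2 (Min (\<Union>V) \<in> \<Union>Q)" "c1 (Min (\<Union>Q) \<in> \<Union>P)"
    using p p' by (auto simp: half_admissible_def)
  have sub: "P \<subseteq> Q" "Q \<subseteq> V"
    using QP by (auto simp: admissible_def)
  then have un: "P \<union> (Q - P) = Q"
    by blast
  show "(case case p of (Q, P) \<Rightarrow> (P, Q - P) of (P, R) \<Rightarrow> (P \<union> R, P)) = p"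
    using p' un by simp
  show "(case p of (Q, P) \<Rightarrow> (P, Q - P)) \<in> Sigma (half_admissible d2 V) (\<lambda>P. half_admissible d1 (V - P))"
    using QP admissible_chain_iff[OF sub(1), of V] cond[OF sub] p' by (simp add: half_admissible_def)
  have "A \<union> \<Union>P \<union> \<Union>(Q - P) = A \<union> \<Union>Q" "V - P - (Q - P) = V - Q"
    using sub by blast+
  then show "(case case p of (Q, P) \<Rightarrow> (P, Q - P) of (P, R) \<Rightarrow>
      basis_vec (sep_word A P, sep_word (A \<union> \<Union>P) R, sep_word (A \<union> \<Union>P \<union> \<Union>R) (V - P - R)))
    = (case p of (Q, P) \<Rightarrow>
      basis_vec (sep_word A P, sep_word (A \<union> \<Union>P) (Q - P), sep_word (A \<union> \<Union>Q) (V - Q)))"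
    using p' by simp
next
  fix p assume p: "p \<in> Sigma (half_admissible d2 V) (\<lambda>P. half_admissible d1 (V - P))"
  obtain P R where p': "p = (P, R)"
    by (cases p)
  have PR: "P \<in> admissible V" "R \<in> admissible (V - P)" "d2 (Min (\<Union>V) \<in> \<Union>P)" "d1 (Min (\<Union>(V - P)) \<in> \<Union>R)"
    using p p' by (auto simp: half_admissible_def)
  have sub: "P \<subseteq> P \<union> R" "P \<union> R \<subseteq> V" and R: "P \<union> R - P = R"
    using PR by (auto simp: admissible_def)
  show "(case case p of (P, R) \<Rightarrow> (P \<union> R, P) of (Q, P) \<Rightarrow> (P, Q - P)) = p"
    using p' R by simp
  have "P \<union> R \<in> admissible V" "P \<in> admissible (P \<union> R)"
    using admissible_chain_iff[OF sub(1), of V] PR(1,2) sub(2) unfolding R by blast+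
  moreover have "c2 (Min (\<Union>V) \<in> \<Union>(P \<union> R))" "c1 (Min (\<Union>(P \<union> R)) \<in> \<Union>P)"
    using cond[OF sub] PR(3,4) unfolding R by blast+
  ultimately show "(case p of (P, R) \<Rightarrow> (P \<union> R, P)) \<in> Sigma (half_admissible c2 V) (half_admissible c1)"
    unfolding half_admissible_def p' prod.case mem_Sigma_iff mem_Collect_eq by blast
qed

lemma Min_Union_eq:
  assumes "separated A V" "W \<subseteq> V" "Min (\<Union>V) \<in> \<Union>W"
  shows "Min (\<Union>W) = Min (\<Union>V)"
proof (rule Min_eqI)
  show "finite (\<Union>W)"
    using separatedD(2)[OF separated_mono[OF assms(1,2) subset_refl]] .
  show "Min (\<Union>V) \<le> y" if "y \<in> \<Union>W" for y
    using that assms(2) separatedD(2)[OF assms(1)] by (intro Min_le) auto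
qed (fact assms(3))

lemma Min_Union_in:
  assumes "separated A V" "V \<noteq> {}"
  shows "Min (\<Union>V) \<in> \<Union>V"
  using separatedD(2,4)[OF assms(1)] assms(2) by (intro Min_in) blast+

text \<open>A subfamily that still covers \<open>?m\<close> has \<open>?m\<close> as its least
  point, so conditions on the minima of \<open>Q\<close> and \<open>V - P\<close> become conditions
  on the position of \<open>?m\<close>.\<close>

lemma half_coassoc:
  assumes "w \<noteq> []"
  shows "tensor_assoc (tensor_map (half_coprod (\<lambda>b. b)) id (half_coprod (\<lambda>b. b) (basis_vec w)))
      = tensor_map id coprod (half_coprod (\<lambda>b. b) (basis_vec w :: 'k::field ncT))"
    and "tensor_assoc (tensor_map (half_coprod Not) id (half_coprod (\<lambda>b. b) (basis_vec w)))
      = tensor_map id (half_coprod (\<lambda>b. b)) (half_coprod Not (basis_vec w :: 'k ncT))"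
    and "tensor_assoc (tensor_map coprod id (half_coprod Not (basis_vec w)))
      = tensor_map id (half_coprod Not) (half_coprod Not (basis_vec w :: 'k ncT))"
proof -
  obtain A V where V: "separated A V" "sep_word A V = w"
    using exists_sep_word by blast
  have ne: "V \<noteq> {}"
    using V assms by auto
  let ?m = "Min (\<Union>V)"
  note m = Min_Union_in[OF V(1) ne]
  \<comment> \<open>The inner map may be a restricted half-coproduct, so the family it acts on has
    to be nonempty: \<open>Q\<close> contains the block of \<open>?m\<close> in one case,
    \<open>V - P\<close> in the other.\<close>
  have in1: "Q \<noteq> {}" if "Q \<in> half_admissible (\<lambda>b. b) V" for Q
    using that by (auto simp: half_admissible_def)
  have in2: "V - P \<noteq> {}" if "P \<in> half_admissible Not V" for P
    using that m by (auto simp: half_admissible_def)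
  have minQ: "Min (\<Union>Q) = ?m" if "Q \<subseteq> V" "?m \<in> \<Union>Q" for Q
    using Min_Union_eq[OF V(1) that] .
  have compl: "?m \<in> \<Union>(Q - P) \<longleftrightarrow> ?m \<in> \<Union>Q \<and> ?m \<notin> \<Union>P" if "P \<subseteq> Q" "Q \<subseteq> V" for P Q
    using separatedD(5)[OF V(1)] that by blast
  have minP: "Min (\<Union>(V - P)) = ?m" if "P \<subseteq> V" "?m \<notin> \<Union>P" for P
    using minQ[of "V - P"] compl[OF that(1) subset_refl] that m by blast
  show "tensor_assoc (tensor_map (half_coprod (\<lambda>b. b)) id (half_coprod (\<lambda>b. b) (basis_vec w)))
      = tensor_map id coprod (half_coprod (\<lambda>b. b) (basis_vec w :: 'k::field ncT))"
    unfolding V(2)[symmetric] half_coprod_True[symmetric]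
  proof (rule half_coassoc_sep_word[OF V(1)])
    fix P Q assume "P \<subseteq> Q" "Q \<subseteq> V"
    then show "?m \<in> \<Union>Q \<and> Min (\<Union>Q) \<in> \<Union>P \<longleftrightarrow> ?m \<in> \<Union>P \<and> True"
      using minQ by (metis Union_mono subsetD)
  qed (use ne in1 in auto)
  show "tensor_assoc (tensor_map (half_coprod Not) id (half_coprod (\<lambda>b. b) (basis_vec w)))
      = tensor_map id (half_coprod (\<lambda>b. b)) (half_coprod Not (basis_vec w :: 'k ncT))"
    unfolding V(2)[symmetric]
  proof (rule half_coassoc_sep_word[OF V(1)])
    fix P Q assume PQ: "P \<subseteq> Q" "Q \<subseteq> V"
    show "?m \<in> \<Union>Q \<and> Min (\<Union>Q) \<notin> \<Union>P \<longleftrightarrow> ?m \<notin> \<Union>P \<and> Min (\<Union>(V - P)) \<in> \<Union>(Q - P)"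
    proof (cases "?m \<in> \<Union>P")
      case True
      moreover have "?m \<in> \<Union>Q"
        using True PQ by blast
      ultimately show ?thesis
        using minQ[OF PQ(2)] by simp
    next
      case False
      then show ?thesis
        using minQ[OF PQ(2)] minP[of P] compl[OF PQ] PQ by (metis subset_trans)
    qed
  qed (use ne in1 in2 in auto)
  show "tensor_assoc (tensor_map coprod id (half_coprod Not (basis_vec w)))
      = tensor_map id (half_coprod Not) (half_coprod Not (basis_vec w :: 'k ncT))"
    unfolding V(2)[symmetric] half_coprod_True[symmetric]
  proof (rule half_coassoc_sep_word[OF V(1)])
    fix P Q assume PQ: "P \<subseteq> Q" "Q \<subseteq> V"
    then show "?m \<notin> \<Union>Q \<and> True \<longleftrightarrow> ?m \<notin> \<Union>P \<and> Min (\<Union>(V - P)) \<notin> \<Union>(Q - P)"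
      using minP[of P] compl[OF PQ] by (metis Union_mono subsetD subset_trans)
  qed (use ne in2 in auto)
qed

lemma coprod_coassoc: "tensor_assoc (tensor_map coprod id (coprod x)) = tensor_map id coprod (coprod x)"
proof (rule lin_eqI[OF lin_compose[OF lin_tensor_assoc lin_compose[OF lin_tensor_map lin_coprod]]
    lin_compose[OF lin_tensor_map lin_coprod]])
  fix w
  obtain A V where V: "separated A V" "sep_word A V = w"
    using exists_sep_word by blast
  show "tensor_assoc (tensor_map coprod id (coprod (basis_vec w))) = tensor_map id coprod (coprod (basis_vec w))"
    unfolding V(2)[symmetric] half_coprod_True[symmetric]
    by (rule half_coassoc_sep_word[OF V(1)]) auto
qed

section \<open>The unshuffle bialgebra\<close>

lemma T_plus_eq: "T_plus = {x. counit_T x = 0}"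
  by (auto simp: T_plus_def counit_T_def in_keys_iff)

lemma lin_eq_on_T_plus:
  assumes "x \<in> T_plus" "lin f" "lin g" "\<And>w. w \<noteq> [] \<Longrightarrow> f (basis_vec w) = g (basis_vec w)"
  shows "f x = g x"
  by (rule lin_eqI[OF assms(2,3)]) (use assms(1,4) in \<open>auto simp: T_plus_def\<close>)

lemma half_coassoc_T_plus:
  assumes "x \<in> T_plus"
  shows "tensor_assoc (tensor_map (half_coprod (\<lambda>b. b)) id (half_coprod (\<lambda>b. b) x))
      = tensor_map id coprod (half_coprod (\<lambda>b. b) x)"
    and "tensor_assoc (tensor_map (half_coprod Not) id (half_coprod (\<lambda>b. b) x))
      = tensor_map id (half_coprod (\<lambda>b. b)) (half_coprod Not x)"
    and "tensor_assoc (tensor_map coprod id (half_coprod Not x))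
      = tensor_map id (half_coprod Not) (half_coprod Not x)"
proof -
  note left = lin_compose[OF lin_tensor_assoc lin_compose[OF lin_tensor_map lin_half_coprod]]
  note right = lin_compose[OF lin_tensor_map lin_half_coprod]
  show "tensor_assoc (tensor_map (half_coprod (\<lambda>b. b)) id (half_coprod (\<lambda>b. b) x))
      = tensor_map id coprod (half_coprod (\<lambda>b. b) x)"
    by (rule lin_eq_on_T_plus[OF assms left right]) (rule half_coassoc)
  show "tensor_assoc (tensor_map (half_coprod Not) id (half_coprod (\<lambda>b. b) x))
      = tensor_map id (half_coprod (\<lambda>b. b)) (half_coprod Not x)"
    by (rule lin_eq_on_T_plus[OF assms left right]) (rule half_coassoc)
  show "tensor_assoc (tensor_map coprod id (half_coprod Not x))
      = tensor_map id (half_coprod Not) (half_coprod Not x)"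
    by (rule lin_eq_on_T_plus[OF assms left right]) (rule half_coassoc)
qed

section \<open>Bookkeeping of unit terms\<close>

lemma coprod_unit: "coprod unit_T = tensor unit_T unit_T"
  by (simp add: unit_T_def)

text \<open>The new unit lands in the middle slot, whichever neighbour it is attached to.\<close>

lemma assoc_map_unit_right:
  "tensor_assoc (tensor_map (\<lambda>x. tensor x unit_T) id t) = tensor_map id (\<lambda>x. tensor unit_T x) t"
  by (rule lin_eqI[OF lin_compose[OF lin_tensor_assoc lin_tensor_map] lin_tensor_map])
    (auto simp: unit_T_def)

lemma assoc_map_unit_left:
  "tensor_assoc (tensor_map (\<lambda>x. tensor unit_T x) id t) = tensor unit_T t"
  by (rule lin_eqI[OF lin_compose[OF lin_tensor_assoc lin_tensor_map] lin_unit_left])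
    (auto simp: unit_T_def)

lemma map_tensor_unit_left:
  assumes "lin f"
  shows "tensor_map id f (tensor unit_T x) = tensor unit_T (f x)"
  by (rule lin_eqI[OF lin_compose[OF lin_tensor_map lin_unit_left] lin_compose[OF lin_unit_left assms]])
    (simp add: unit_T_def)

lemma assoc_map_tensor_unit_right:
  fixes f :: "'k::field ncT \<Rightarrow> 'k ncT2"
  assumes "lin f"
  shows "tensor_assoc (tensor_map f id (tensor x unit_T)) = tensor_map id (\<lambda>x. tensor x unit_T) (f x)"
proof (rule lin_eqI[OF lin_compose[OF lin_tensor_assoc lin_compose[OF lin_tensor_map lin_unit_right]]
    lin_compose[OF lin_tensor_map assms]])
  fix w
  have "tensor_assoc (tensor t unit_T) = tensor_map id (\<lambda>x. tensor x unit_T) t"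
    for t :: "'k ncT2"
    by (rule lin_eqI[OF lin_compose[OF lin_tensor_assoc lin_unit_right] lin_tensor_map])
      (auto simp: unit_T_def)
  then show "tensor_assoc (tensor_map f id (tensor (basis_vec w) unit_T))
      = tensor_map id (\<lambda>x. tensor x unit_T) (f (basis_vec w))"
    by (simp add: unit_T_def)
qed

text \<open>The second factor is the unit, so \<open>f\<close> is seen only there; at the unit the
  coproduct and both unit insertions agree.\<close>

lemma map_tensor_unit_right_cong:
  assumes "f unit_T = g unit_T"
  shows "tensor_map id f (tensor x unit_T) = tensor_map id g (tensor x unit_T)"
  by (rule lin_eqI[OF lin_compose[OF lin_tensor_map lin_unit_right] lin_compose[OF lin_tensor_map lin_unit_right]])
    (use assms in \<open>simp add: unit_T_def\<close>)

lemma map_tensor_unit_left_cong: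
  assumes "f unit_T = g unit_T"
  shows "tensor_map f id (tensor unit_T x) = tensor_map g id (tensor unit_T x)"
  by (rule lin_eqI[OF lin_compose[OF lin_tensor_map lin_unit_left] lin_compose[OF lin_tensor_map lin_unit_left]])
    (use assms in \<open>simp add: unit_T_def\<close>)

lemma coprod_conc: "coprod (conc x y) = coprod x \<odot> coprod y"
proof (rule lin_eqI[OF lin_compose[OF lin_coprod lin_conc_left] lin_compose[OF lin_tmul_left lin_coprod]])
  fix v
  show "coprod (conc (basis_vec v) y) = coprod (basis_vec v) \<odot> coprod y"
    by (rule lin_eqI[OF lin_compose[OF lin_coprod lin_conc_right] lin_compose[OF lin_tmul_right lin_coprod]])
      (simp add: coprod_word_append)
qed

lemma half_coprod_conc:
  assumes "x \<in> T_plus"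
  shows "half_coprod c (conc x y) = half_coprod c x \<odot> coprod y"
proof (rule lin_eq_on_T_plus[OF assms lin_compose[OF lin_half_coprod lin_conc_left]
    lin_compose[OF lin_tmul_left lin_half_coprod]])
  fix v :: "ncp list" assume v: "v \<noteq> []"
  show "half_coprod c (conc (basis_vec v) y) = half_coprod c (basis_vec v) \<odot> coprod y"
    by (rule lin_eqI[OF lin_compose[OF lin_half_coprod lin_conc_right] lin_compose[OF lin_tmul_right lin_coprod]])
      (simp add: half_coprod_def half_word_append[OF v])
qed

section \<open>Counit, splitting and the augmentation ideal\<close>

text \<open>A concatenation is empty only if both words are, so the constant coefficient of a
  product receives a single contribution.\<close>

lemma counit_conc:
  fixes x y :: "'k::field ncT"
  shows "counit_T (conc x y) = counit_T x * counit_T y"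
proof -
  have ext: "Poly_Mapping.lookup (lin_ext f z) k
      = (\<Sum>b\<in>Poly_Mapping.keys z. Poly_Mapping.lookup z b * Poly_Mapping.lookup (f b) k)"
    for f :: "ncp list \<Rightarrow> 'k ncT" and z k
    by (simp add: lin_ext_def lookup_sum)
  have inner: "Poly_Mapping.lookup (lin_ext (\<lambda>w. basis_vec (v @ w)) y) []
      = (if v = [] then Poly_Mapping.lookup y [] else 0)" for v
    by (simp add: ext lookup_basis_vec in_keys_iff if_distrib cong: if_cong)
  show ?thesis
    unfolding counit_T_def conc_def
    by (subst ext) (simp add: inner in_keys_iff if_distrib cong: if_cong)
qed

lemma counit_basis_vec: "counit_T (basis_vec w) = (if w = [] then 1 else 0)"
  by (simp add: counit_T_def lookup_basis_vec)

lemma half_admissible_True_iff: "R \<in> half_admissible (\<lambda>_. True) V \<longleftrightarrow> R \<in> admissible V"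
  by (simp add: half_admissible_def)

lemma empty_admissible: "{} \<in> admissible V" and self_admissible: "V \<in> admissible V"
  by (auto simp: admissible_def)

text \<open>The counit keeps the terms with empty left word, and \<open>R = {}\<close> is the only
  one; on the right, \<open>R = V\<close> is.\<close>

lemma counit_left_coprod:
  "lin_ext (\<lambda>(b, c). vscale (counit_T (basis_vec b)) (basis_vec c)) (coprod x) = (x :: 'k::field ncT)"
proof (rule lin_eqI[OF lin_compose[OF lin_lin_ext lin_coprod] lin_id])
  fix w
  obtain A V where V: "separated A V" "sep_word A V = w"
    using exists_sep_word by blast
  note D = separatedD[OF V(1)]
  have nil: "sep_word A R = [] \<longleftrightarrow> R = {}" if "R \<in> half_admissible (\<lambda>_. True) V" for R
  proof (rule sep_word_eq_Nil_iff)
    show "separated A R"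
      using that by (intro separated_mono[OF V(1)]) (auto simp: half_admissible_def admissible_def)
  qed
  have "lin_ext (\<lambda>(b, c). vscale (counit_T (basis_vec b)) (basis_vec c)) (coprod (basis_vec w :: 'k ncT))
      = (\<Sum>R\<in>half_admissible (\<lambda>_. True) V.
          vscale (counit_T (basis_vec (sep_word A R))) (basis_vec (sep_word (A \<union> \<Union>R) (V - R))))"
    by (simp add: V(2)[symmetric] coprod_word_sep_word[OF V(1)] linD(5)[OF lin_lin_ext])
  also have "\<dots> = (\<Sum>R\<in>half_admissible (\<lambda>_. True) V. if R = {} then basis_vec w else 0)"
    using V(2) by (intro sum.cong) (auto simp: counit_basis_vec nil)
  also have "\<dots> = basis_vec w"
    using finite_half_admissible[OF D(1)] by (simp add: half_admissible_True_iff empty_admissible)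
  finally show "lin_ext (\<lambda>(b, c). vscale (counit_T (basis_vec b)) (basis_vec c))
      (coprod (basis_vec w :: 'k ncT)) = basis_vec w" .
qed

lemma counit_right_coprod:
  "lin_ext (\<lambda>(b, c). vscale (counit_T (basis_vec c)) (basis_vec b)) (coprod x) = (x :: 'k::field ncT)"
proof (rule lin_eqI[OF lin_compose[OF lin_lin_ext lin_coprod] lin_id])
  fix w
  obtain A V where V: "separated A V" "sep_word A V = w"
    using exists_sep_word by blast
  note D = separatedD[OF V(1)]
  have nil: "sep_word (A \<union> \<Union>R) (V - R) = [] \<longleftrightarrow> R = V" if "R \<in> half_admissible (\<lambda>_. True) V" for R
  proof -
    have "R \<in> admissible V" "R \<subseteq> V"
      using that by (auto simp: half_admissible_def admissible_def)
    then show ?thesis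
      using sep_word_eq_Nil_iff[OF separated_admissible[OF V(1)]] by blast
  qed
  have "lin_ext (\<lambda>(b, c). vscale (counit_T (basis_vec c)) (basis_vec b)) (coprod (basis_vec w :: 'k ncT))
      = (\<Sum>R\<in>half_admissible (\<lambda>_. True) V.
          vscale (counit_T (basis_vec (sep_word (A \<union> \<Union>R) (V - R)))) (basis_vec (sep_word A R)))"
    by (simp add: V(2)[symmetric] coprod_word_sep_word[OF V(1)] linD(5)[OF lin_lin_ext])
  also have "\<dots> = (\<Sum>R\<in>half_admissible (\<lambda>_. True) V. if R = V then basis_vec w else 0)"
    using V(2) by (intro sum.cong) (auto simp: counit_basis_vec nil)
  also have "\<dots> = basis_vec w"
    using finite_half_admissible[OF D(1)] by (simp add: half_admissible_True_iff self_admissible)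
  finally show "lin_ext (\<lambda>(b, c). vscale (counit_T (basis_vec c)) (basis_vec b))
      (coprod (basis_vec w :: 'k ncT)) = basis_vec w" .
qed

text \<open>The least point either lies in \<open>R\<close> or does not. On the empty word the
  right-hand side would count the unit tensor twice, hence the restriction to
  \<open>T_plus\<close>.\<close>

lemma half_coprod_split:
  assumes "x \<in> T_plus"
  shows "coprod x = half_coprod (\<lambda>b. b) x + half_coprod Not x"
proof (rule lin_eq_on_T_plus[OF assms lin_coprod lin_add[OF lin_half_coprod lin_half_coprod]])
  fix w :: "ncp list" assume w: "w \<noteq> []"
  obtain A V where V: "separated A V" "sep_word A V = w"
    using exists_sep_word by blast
  have ne: "V \<noteq> {}"
    using V w by auto
  have fin: "finite (half_admissible c V)" for c
    using separatedD(1)[OF V(1)] by (rule finite_half_admissible)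
  have "half_admissible (\<lambda>_. True) V = half_admissible (\<lambda>b. b) V \<union> half_admissible Not V"
    "half_admissible (\<lambda>b. b) V \<inter> half_admissible Not V = {}"
    by (auto simp: half_admissible_def)
  then show "coprod (basis_vec w) = half_coprod (\<lambda>b. b) (basis_vec w) + half_coprod Not (basis_vec w)"
    using V(2) ne
    by (simp add: half_coprod_True[symmetric] half_coprod_sep_word[OF V(1)] V(2)[symmetric]
      sum.union_disjoint[OF fin fin])
qed

lemma lin_in_span:
  assumes "lin f" "\<And>b. b \<in> Poly_Mapping.keys x \<Longrightarrow> f (basis_vec b) \<in> module.span vscale S"
  shows "f x \<in> module.span vscale S"
  unfolding lin_eq_lin_ext[OF assms(1), of x] lin_ext_def
  using assms(2) by (intro vs.span_sum vs.span_scale)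

lemma basis_vec_in_tensor_subspace:
  "u \<noteq> [] \<Longrightarrow> v \<noteq> [] \<Longrightarrow> basis_vec (u, v) \<in> tensor_subspace T_plus T_plus"
  unfolding tensor_subspace_def
  by (intro vs.span_base CollectI exI[of _ "basis_vec u"] exI[of _ "basis_vec v"]) (simp add: T_plus_def)

lemma split_term_in_tensor_subspace:
  assumes "separated A V" "R \<in> admissible V" "R \<noteq> {}" "R \<noteq> V"
  shows "basis_vec (sep_word A R, sep_word (A \<union> \<Union>R) (V - R)) \<in> tensor_subspace T_plus T_plus"
proof (rule basis_vec_in_tensor_subspace)
  have "R \<subseteq> V"
    using assms(2) by (auto simp: admissible_def)
  then show "sep_word A R \<noteq> []"
    using sep_word_eq_Nil_iff[OF separated_mono[OF assms(1) _ subset_refl]] assms(3) by blast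
  show "sep_word (A \<union> \<Union>R) (V - R) \<noteq> []"
    using sep_word_eq_Nil_iff[OF separated_admissible[OF assms(1,2)]] assms(4) \<open>R \<subseteq> V\<close> by blast
qed

text \<open>The subtracted term is exactly \<open>R = V\<close>, while \<open>R = {}\<close> is
  already excluded because \<open>R\<close> has to cover the least point.\<close>

lemma coprod_prec_in:
  fixes x :: "'k::field ncT"
  assumes "x \<in> T_plus"
  shows "coprod_prec x \<in> tensor_subspace T_plus T_plus"
  unfolding tensor_subspace_def
proof (rule lin_in_span[OF lin_coprod_prec])
  fix w assume "w \<in> Poly_Mapping.keys x"
  then have w: "w \<noteq> []"
    using assms by (auto simp: T_plus_def)
  obtain A V where V: "separated A V" "sep_word A V = w"
    using exists_sep_word by blast
  have ne: "V \<noteq> {}"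
    using V w by auto
  have "V \<in> half_admissible (\<lambda>b. b) V"
    using Min_Union_in[OF V(1) ne] by (simp add: half_admissible_def self_admissible)
  then have "coprod_prec (basis_vec w :: 'k ncT) = (\<Sum>R\<in>half_admissible (\<lambda>b. b) V - {V}.
      basis_vec (sep_word A R, sep_word (A \<union> \<Union>R) (V - R)))"
    using finite_half_admissible[OF separatedD(1)[OF V(1)]] ne
    by (simp add: coprod_prec_eq V(2)[symmetric] half_coprod_sep_word[OF V(1)] unit_T_def sum_diff1)
  moreover have "\<dots> \<in> tensor_subspace T_plus T_plus"
    unfolding tensor_subspace_def
    using split_term_in_tensor_subspace[OF V(1), unfolded tensor_subspace_def]
    by (intro vs.span_sum) (auto simp: half_admissible_def)
  ultimately show "coprod_prec (basis_vec w :: 'k ncT) \<in> module.span vscale {tensor x y |x y. x \<in> T_plus \<and> y \<in> T_plus}"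
    by (simp add: tensor_subspace_def)
qed

text \<open>Here the subtracted term is \<open>R = {}\<close>, and \<open>R = V\<close> is excluded
  because it covers the least point.\<close>

lemma coprod_succ_in:
  fixes x :: "'k::field ncT"
  assumes "x \<in> T_plus"
  shows "coprod_succ x \<in> tensor_subspace T_plus T_plus"
  unfolding tensor_subspace_def
proof (rule lin_in_span[OF lin_coprod_succ])
  fix w assume "w \<in> Poly_Mapping.keys x"
  then have w: "w \<noteq> []"
    using assms by (auto simp: T_plus_def)
  obtain A V where V: "separated A V" "sep_word A V = w"
    using exists_sep_word by blast
  have ne: "V \<noteq> {}"
    using V w by auto
  have "{} \<in> half_admissible Not V"
    by (simp add: half_admissible_def empty_admissible)
  then have "coprod_succ (basis_vec w :: 'k ncT) = (\<Sum>R\<in>half_admissible Not V - {{}}.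
      basis_vec (sep_word A R, sep_word (A \<union> \<Union>R) (V - R)))"
    using finite_half_admissible[OF separatedD(1)[OF V(1)]] ne
    by (simp add: coprod_succ_eq V(2)[symmetric] half_coprod_sep_word[OF V(1)] unit_T_def sum_diff1)
  moreover have "\<dots> \<in> tensor_subspace T_plus T_plus"
    unfolding tensor_subspace_def
    using split_term_in_tensor_subspace[OF V(1), unfolded tensor_subspace_def] Min_Union_in[OF V(1) ne]
    by (intro vs.span_sum) (auto simp: half_admissible_def)
  ultimately show "coprod_succ (basis_vec w :: 'k ncT) \<in> module.span vscale {tensor x y |x y. x \<in> T_plus \<and> y \<in> T_plus}"
    by (simp add: tensor_subspace_def)
qed

lemma bialgebra_ncT: "bialgebra (conc :: 'k::field ncT \<Rightarrow> 'k ncT \<Rightarrow> 'k ncT) unit_T coprod counit_T"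
proof (rule bialgebra.intro)
  show "Vector_Spaces.linear vscale (*) (counit_T :: 'k ncT \<Rightarrow> 'k)"
  proof -
    have "vector_space ((*) :: 'k \<Rightarrow> 'k \<Rightarrow> 'k)"
      by unfold_locales (simp_all add: algebra_simps)
    then show ?thesis
      unfolding Vector_Spaces.linear_iff
      by (intro conjI allI vector_space_vscale) (simp_all add: counit_T_def lookup_add)
  qed
  show "counit_T unit_T = (1 :: 'k)"
    by (simp add: unit_T_def counit_basis_vec)
qed (rule lin_conc_right lin_conc_left conc_assoc conc_unit_left conc_unit_right lin_coprod coprod_coassoc
  counit_left_coprod counit_right_coprod coprod_conc coprod_unit counit_conc)+

theorem mainTheorem2:
  shows "unshuffle_bialgebra
           (conc :: 'k::field_char_0 ncT \<Rightarrow> 'k ncT \<Rightarrow> 'k ncT) unit_T coprod counit_T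
           T_plus coprod_prec coprod_succ"
proof -
  interpret bialgebra "conc :: 'k ncT \<Rightarrow> 'k ncT \<Rightarrow> 'k ncT" unit_T coprod counit_T
    by (rule bialgebra_ncT)
  have red: "reduced_coproduct = (\<lambda>x. coprod x - tensor x unit_T - tensor unit_T x)"
    by (rule ext) (rule reduced_coproduct_def)
  note expand = tensor_map_diff_left tensor_map_diff_right linD(2)[OF lin_tensor_assoc]
    linD(2)[OF lin_tensor_map]
  note unit_rules = assoc_map_unit_right assoc_map_unit_left
    map_tensor_unit_left[OF lin_half_coprod] map_tensor_unit_left[OF lin_unit_left]
    map_tensor_unit_left[OF lin_unit_right]
    assoc_map_tensor_unit_right[OF lin_half_coprod]
  show ?thesis
  proof (intro unshuffle_bialgebra.intro unshuffle_bialgebra_axioms.intro bialgebra_ncT)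
    fix x y :: "'k ncT" assume x: "x \<in> T_plus"
    show "coprod_prec x \<in> tensor_subspace T_plus T_plus" "coprod_succ x \<in> tensor_subspace T_plus T_plus"
      using x by (rule coprod_prec_in coprod_succ_in)+
    show "reduced_coproduct x = coprod_prec x + coprod_succ x"
      by (simp add: red coprod_prec_eq coprod_succ_eq half_coprod_split[OF x])
    show "tensor_assoc (tensor_map coprod_prec id (coprod_prec x)) = tensor_map id reduced_coproduct (coprod_prec x)"
    proof -
      \<comment> \<open>On \<open>x \<otimes> 1\<close> each of the three parts of the reduced
        coproduct gives \<open>x \<otimes> 1 \<otimes> 1\<close>, with signs plus, minus, minus. As
        this term is itself subtracted, one positive copy remains, matching the one on the left-hand
        side.\<close>
      have "tensor_map id coprod (tensor x unit_T) = tensor_map id (tensor unit_T) (tensor x unit_T)"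
        "tensor_map id (\<lambda>x. tensor x unit_T) (tensor x unit_T) = tensor_map id (tensor unit_T) (tensor x unit_T)"
        by (rule map_tensor_unit_right_cong, simp add: coprod_unit)+
      then show ?thesis
        unfolding red coprod_prec_eq expand half_coassoc_T_plus[OF x] unit_rules by simp
    qed
    \<comment> \<open>Both sides carry the same corrections: \<open>half_coprod Not x\<close>
      followed by a unit and \<open>half_coprod (\<lambda>b. b) x\<close> preceded by a unit, both
      negative, and \<open>1 \<otimes> x \<otimes> 1\<close>.\<close>
    show "tensor_assoc (tensor_map coprod_succ id (coprod_prec x)) = tensor_map id coprod_prec (coprod_succ x)"
      unfolding coprod_prec_eq coprod_succ_eq expand half_coassoc_T_plus[OF x] unit_rules by simp
    show "tensor_assoc (tensor_map reduced_coproduct id (coprod_succ x)) = tensor_map id coprod_succ (coprod_succ x)"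
    proof -
      \<comment> \<open>The mirror image: the unit now stands in the first factor, and one positive
        \<open>1 \<otimes> 1 \<otimes> x\<close> is left over on each side.\<close>
      have "tensor_map coprod id (tensor unit_T x) = tensor_map (tensor unit_T) id (tensor unit_T x)"
        "tensor_map (\<lambda>x. tensor x unit_T) id (tensor unit_T x) = tensor_map (tensor unit_T) id (tensor unit_T x)"
        by (rule map_tensor_unit_left_cong, simp add: coprod_unit)+
      then show ?thesis
        unfolding red coprod_succ_eq expand half_coassoc_T_plus[OF x] by (simp add: unit_rules)
    qed
    show "coprod_prec (conc x y) + tensor (conc x y) unit_T = (coprod_prec x + tensor x unit_T) \<odot> coprod y"
      by (simp add: coprod_prec_eq half_coprod_conc[OF x])
    show "coprod_succ (conc x y) + tensor unit_T (conc x y) = (coprod_succ x + tensor unit_T x) \<odot> coprod y"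
      by (simp add: coprod_succ_eq half_coprod_conc[OF x])
  qed (rule T_plus_eq lin_coprod_prec lin_coprod_succ)+
qed

end
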